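(* Let $M$ be a purely 2-unrectifiable metric space (for example, the Heisenberg group $\mathbb{H}^1$ endowed with the Carnot-Carathéodory metric). Let $\gamma: I\to M$ be a Lipschitz path and let $[\gamma]$ be its homotopy class of Lipschitz paths. Then there exists a Lipschitz path $\gamma_\infty\in[\gamma]$ such that $$\ell(\gamma_\infty)=\inf\{\ell(\alpha)\mid \alpha\in[\gamma]\}.$$ Moreover, for every $\alpha\in[\gamma]$, $\operatorname{Im}(\gamma_\infty)\subset\operatorname{Im}(\alpha)$.
   Context: $I=[0,1]$ with the Euclidean metric; all paths have domain $I$; $I\times I$ carries the $L^1$ metric $d^1((s,t),(s',t'))=|s-s'|+|t-t'|$. $\ell(\gamma)$ denotes the length of a path $\gamma$ in $M$ (supremum over partitions of sums of distances between consecutive points). A metric space $M$ is purely 2-unrectifiable (in the sense of Ambrosio-Kirchheim) if for every Borel set $S\subset\mathbb{R}^2$ and every Lipschitz map $f:S\to M$, the 2-dimensional Hausdorff measure of $f(S)$ is zero. Two Lipschitz paths $\gamma,\gamma':I\to M$ are homotopic rel endpoints if $\gamma(0)=\gamma'(0)$, $\gamma(1)=\gamma'(1)$, and there is a Lipschitz map $H:I\times I\to M$ (a homotopy from $\gamma$ to $\gamma'$) with $H(t,0)=\gamma(t)$, $H(t,1)=\gamma'(t)$, $H(0,s)=\gamma(0)$, $H(1,s)=\gamma(1)$ for all $s,t\in I$. The homotopy class $[\gamma]$ of a Lipschitz path $\gamma$ is the set of all Lipschitz paths homotopic rel endpoints to $\gamma$. The Heisenberg group $\mathbb{H}^1$ is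 $\mathbb{R}^3$ with the horizontal distribution spanned by the orthonormal vector fields $X=\partial_x-\tfrac{y}{2}\partial_z$ and $Y=\partial_y+\tfrac{x}{2}\partial_z$; the Carnot-Carathéodory distance between two points is the infimum of the lengths of absolutely continuous paths joining them that are tangent to this distribution almost everywhere. It is a known fact (Ambrosio-Kirchheim) that this metric space is purely 2-unrectifiable. *)

theory Defs
  imports "HOL-Analysis.Analysis"
begin

text \<open>
  The metric space is a type of class \<open>metric_space\<close>. Paths are total functions on
  \<open>real\<close> of which only the restriction to \<open>{0..1}\<close> matters, as usual for \<open>path_image\<close>.
\<close>

text \<open>
  The \<open>k\<close>-dimensional Hausdorff outer measure, normalised by the volume of the unit ball.
  Covering sets are required to be bounded because \<open>diameter\<close> has no meaning on unbounded
  sets; the conditional only matters for \<open>k = 0\<close>, where an empty set must contribute 0.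
\<close>

definition hausdorff_premeasure :: "nat \<Rightarrow> real \<Rightarrow> 'a::metric_space set \<Rightarrow> ennreal" where
  "hausdorff_premeasure k \<delta> A =
     (INF E \<in> {E :: nat \<Rightarrow> 'a set.
                 A \<subseteq> (\<Union>i. E i) \<and> (\<forall>i. bounded (E i) \<and> diameter (E i) \<le> \<delta>)}.
        \<Sum>i. if E i = {} then 0
             else ennreal (unit_ball_vol (real k) * (diameter (E i) / 2) ^ k))"

definition hausdorff_measure :: "nat \<Rightarrow> 'a::metric_space set \<Rightarrow> ennreal" where
  "hausdorff_measure k A = (SUP \<delta> \<in> {0<..}. hausdorff_premeasure k \<delta> A)"

text \<open>The metric of \<open>real \<times> real\<close> is the Euclidean one.\<close>

definition purely_2_unrectifiable :: "'a::metric_space itself \<Rightarrow> bool" where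
  "purely_2_unrectifiable _ \<longleftrightarrow>
     (\<forall>(S :: (real \<times> real) set) (f :: real \<times> real \<Rightarrow> 'a).
        S \<in> sets borel \<longrightarrow> (\<exists>L. L-lipschitz_on S f) \<longrightarrow> hausdorff_measure 2 (f ` S) = 0)"

definition lipschitz_path :: "(real \<Rightarrow> 'a::metric_space) \<Rightarrow> bool" where
  "lipschitz_path \<gamma> \<longleftrightarrow> (\<exists>L. L-lipschitz_on {0..1} \<gamma>)"

definition path_length :: "(real \<Rightarrow> 'a::metric_space) \<Rightarrow> ennreal" where
  "path_length \<gamma> =
     (SUP (n, t) \<in> {(n :: nat, t :: nat \<Rightarrow> real).
                      t 0 = 0 \<and> t n = 1 \<and> (\<forall>i<n. t i \<le> t (Suc i))}.
        ennreal (\<Sum>i<n. dist (\<gamma> (t i)) (\<gamma> (t (Suc i)))))"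

text \<open>
  The Lipschitz condition on the unit square is spelled out because it refers to the
  \<open>L\<^sup>1\<close> metric there, whereas \<open>dist\<close> on \<open>real \<times> real\<close> is Euclidean.
\<close>

definition lipschitz_square :: "(real \<times> real \<Rightarrow> 'a::metric_space) \<Rightarrow> bool" where
  "lipschitz_square H \<longleftrightarrow>
     (\<exists>L\<ge>0. \<forall>s\<in>{0..1}. \<forall>t\<in>{0..1}. \<forall>s'\<in>{0..1}. \<forall>t'\<in>{0..1}.
        dist (H (s, t)) (H (s', t')) \<le> L * (\<bar>s - s'\<bar> + \<bar>t - t'\<bar>))"

definition lipschitz_homotopic ::
    "(real \<Rightarrow> 'a::metric_space) \<Rightarrow> (real \<Rightarrow> 'a) \<Rightarrow> bool" where
  "lipschitz_homotopic \<gamma> \<gamma>' \<longleftrightarrow>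
     lipschitz_path \<gamma> \<and> lipschitz_path \<gamma>' \<and> \<gamma> 0 = \<gamma>' 0 \<and> \<gamma> 1 = \<gamma>' 1 \<and>
     (\<exists>H :: real \<times> real \<Rightarrow> 'a. lipschitz_square H \<and>
        (\<forall>t\<in>{0..1}. H (t, 0) = \<gamma> t \<and> H (t, 1) = \<gamma>' t) \<and>
        (\<forall>s\<in>{0..1}. H (0, s) = \<gamma> 0 \<and> H (1, s) = \<gamma> 1))"

definition homotopy_class :: "(real \<Rightarrow> 'a::metric_space) \<Rightarrow> (real \<Rightarrow> 'a) set" where
  "homotopy_class \<gamma> = {\<alpha>. lipschitz_homotopic \<gamma> \<alpha>}"

end

theory Submission
  imports Defs
begin

text \<open>
  Since \<open>M\<close> is purely 2-unrectifiable, a Lipschitz homotopy has an \<open>H\<^sup>2\<close>-null image, so almost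
  every sphere meets the image in a totally disconnected set. The homotopy is therefore constant on
  connected components of generic level sets, and these separate the square: a contractible loop is
  pinched together like a path running around a tree. Let \<open>h(s)\<close> be the infimal length of the paths
  joined to \<open>\<gamma>\<close> restricted to \<open>[0,s]\<close> by a continuous homotopy with \<open>H\<^sup>2\<close>-null image; continuous
  homotopies are needed because a disc gets cut along mere continua. The
  pinching yields the tree inequality \<open>d(\<gamma>(s),\<gamma>(t)) \<le> h(s) + h(t) - 2 min h\<close>, the minimum being over
  \<open>[s,t]\<close>. Sending \<open>s\<close> to the first later point of height \<open>min h\<close>, now over \<open>[s,1]\<close>, gives a path of
  length at most \<open>h(1)\<close>, and sliding down the heights is an explicit Lipschitz homotopy from \<open>\<gamma>\<close> to
  it. The tree inequality for \<open>\<gamma>\<close> followed by the reverse of \<open>\<alpha>\<close> shows that \<open>\<alpha>\<close> passes through all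
  its points.
\<close>

section \<open>Two-dimensional Hausdorff null sets\<close>

text \<open>\<open>M\<close> is assumed neither complete nor proper, so compactness cannot produce a
  minimiser: a class may have no cheapest representative in sight, and the shortest path has to be
  assembled from points of \<open>\<gamma>\<close> itself. The function \<open>h\<close> codes a
  real tree, with distance \<open>h s + h t - 2 * min h\<close> between parameters \<open>s\<close>
  and \<open>t\<close>, and the tree inequality says that \<open>\<gamma>\<close> factors through
  this tree by a 1-Lipschitz map. The shortest path is the image of the branch from the root to the
  endpoint; the point of that branch assigned to \<open>s\<close> is the meet of \<open>s\<close>
  and the endpoint, whence the minimum over \<open>[s,1]\<close>. Pinching rests on a fact about the
  plane: a closed set separating two points has a component that separates them. On such a component
  of a generic level set of the distance, the homotopy takes values in a connected part of a sphere
  in the null image, hence a single value.\<close>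

lemma hausdorff_measure_2_zero_iff:
  fixes S :: "'a::metric_space set"
  shows "hausdorff_measure 2 S = 0 \<longleftrightarrow>
    (\<forall>e>0. \<exists>E :: nat \<Rightarrow> 'a set. S \<subseteq> (\<Union>i. E i) \<and> (\<forall>i. bounded (E i)) \<and>
       (\<Sum>i. ennreal ((diameter (E i))\<^sup>2)) < ennreal e)"
    (is "_ \<longleftrightarrow> ?R")
proof -
  have term_eq: "(if A = {} then 0 else ennreal (unit_ball_vol (real 2) * (diameter A / 2) ^ 2))
      = ennreal (pi / 4) * ennreal ((diameter A)\<^sup>2)" for A :: "'a set"
    by (auto simp: unit_ball_vol_2 power_divide ennreal_mult'[symmetric])
  have pre: "hausdorff_premeasure 2 \<delta> S =
     (INF E \<in> {E :: nat \<Rightarrow> 'a set. S \<subseteq> (\<Union>i. E i) \<and> (\<forall>i. bounded (E i) \<and> diameter (E i) \<le> \<delta>)}.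
        ennreal (pi / 4) * (\<Sum>i. ennreal ((diameter (E i))\<^sup>2)))" for \<delta>
    unfolding hausdorff_premeasure_def term_eq by simp
  show ?thesis
  proof
    assume "hausdorff_measure 2 S = 0"
    moreover have "hausdorff_premeasure 2 1 S \<le> hausdorff_measure 2 S"
      unfolding hausdorff_measure_def by (rule SUP_upper) simp
    ultimately have 0: "hausdorff_premeasure 2 1 S = 0" by simp
    show ?R
    proof (intro allI impI)
      fix e :: real assume "e > 0"
      then have "hausdorff_premeasure 2 1 S < ennreal (pi / 4 * e)"
        by (simp add: 0)
      then obtain E :: "nat \<Rightarrow> 'a set" where E: "S \<subseteq> (\<Union>i. E i)" "\<And>i. bounded (E i)"
        and lt: "ennreal (pi / 4) * (\<Sum>i. ennreal ((diameter (E i))\<^sup>2)) < ennreal (pi / 4 * e)"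
        unfolding pre INF_less_iff by auto
      have "(\<Sum>i. ennreal ((diameter (E i))\<^sup>2)) < ennreal e"
      proof (rule ccontr)
        assume "\<not> ?thesis"
        then have "ennreal (pi / 4) * ennreal e \<le> ennreal (pi / 4) * (\<Sum>i. ennreal ((diameter (E i))\<^sup>2))"
          by (intro mult_left_mono) auto
        moreover have "ennreal (pi / 4) * ennreal e = ennreal (pi / 4 * e)"
          using \<open>e > 0\<close> by (intro ennreal_mult'[symmetric]) auto
        ultimately show False using lt by simp
      qed
      with E show "\<exists>E :: nat \<Rightarrow> 'a set. S \<subseteq> (\<Union>i. E i) \<and> (\<forall>i. bounded (E i)) \<and>
       (\<Sum>i. ennreal ((diameter (E i))\<^sup>2)) < ennreal e" by blast
    qed
  next
    assume R: ?R
    have "hausdorff_premeasure 2 \<delta> S \<le> 0" if "\<delta> > 0" for \<delta>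
    proof (rule ennreal_le_epsilon)
      fix e :: real assume "e > 0"
      \<comment> \<open>The cap \<open>\<delta>\<^sup>2\<close> bounds each single term of the sum,
        so a cheap cover is automatically fine and the scale drops out.\<close>
      define e' where "e' = min e (\<delta>\<^sup>2)"
      have "e' > 0" using \<open>e > 0\<close> \<open>\<delta> > 0\<close> by (simp add: e'_def)
      then obtain E :: "nat \<Rightarrow> 'a set" where E: "S \<subseteq> (\<Union>i. E i)" "\<And>i. bounded (E i)"
        and lt: "(\<Sum>i. ennreal ((diameter (E i))\<^sup>2)) < ennreal e'"
        using R by meson
      have "diameter (E i) \<le> \<delta>" for i
      proof -
        have "(\<Sum>j\<in>{i}. ennreal ((diameter (E j))\<^sup>2)) \<le> (\<Sum>j. ennreal ((diameter (E j))\<^sup>2))"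
          by (rule sum_le_suminf) auto
        also note lt
        finally have "(diameter (E i))\<^sup>2 < e'"
          by (simp add: ennreal_less_iff)
        then have "(diameter (E i))\<^sup>2 \<le> \<delta>\<^sup>2" by (simp add: e'_def)
        then show ?thesis by (rule power2_le_imp_le) (use \<open>\<delta> > 0\<close> in simp)
      qed
      then have "hausdorff_premeasure 2 \<delta> S
          \<le> ennreal (pi / 4) * (\<Sum>i. ennreal ((diameter (E i))\<^sup>2))"
        unfolding pre using E by (intro INF_lower) auto
      also have "\<dots> \<le> 1 * ennreal e'"
        using lt pi_less_4 by (intro mult_mono) (auto simp: ennreal_le_1)
      also have "\<dots> \<le> 0 + ennreal e" by (simp add: e'_def ennreal_leI)
      finally show "hausdorff_premeasure 2 \<delta> S \<le> 0 + ennreal e" .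
    qed
    then have "hausdorff_measure 2 S \<le> 0"
      unfolding hausdorff_measure_def by (intro SUP_least) auto
    then show "hausdorff_measure 2 S = 0" by simp
  qed
qed

lemma hausdorff_measure_2_zero_subset:
  fixes S T :: "'a::metric_space set"
  assumes "hausdorff_measure 2 S = 0" "T \<subseteq> S"
  shows "hausdorff_measure 2 T = 0"
  unfolding hausdorff_measure_2_zero_iff
proof (intro allI impI)
  fix e :: real assume "e > 0"
  then obtain E :: "nat \<Rightarrow> 'a set" where "S \<subseteq> (\<Union>i. E i)" "\<forall>i. bounded (E i)"
      "(\<Sum>i. ennreal ((diameter (E i))\<^sup>2)) < ennreal e"
    using assms(1) unfolding hausdorff_measure_2_zero_iff by meson
  with assms(2) show "\<exists>E :: nat \<Rightarrow> 'a set. T \<subseteq> (\<Union>i. E i) \<and> (\<forall>i. bounded (E i)) \<and>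
       (\<Sum>i. ennreal ((diameter (E i))\<^sup>2)) < ennreal e"
    by (intro exI[of _ E]) auto
qed

lemma hausdorff_measure_2_zero_Un:
  fixes S T :: "'a::metric_space set"
  assumes S: "hausdorff_measure 2 S = 0" and T: "hausdorff_measure 2 T = 0"
  shows "hausdorff_measure 2 (S \<union> T) = 0"
  unfolding hausdorff_measure_2_zero_iff
proof (intro allI impI)
  fix e :: real assume "e > 0"
  \<comment> \<open>Quarters rather than halves: the limit of the partial sums gives only a weak
    inequality, and the slack makes the final one strict.\<close>
  then have "e / 4 > 0" by simp
  obtain A :: "nat \<Rightarrow> 'a set" where A: "S \<subseteq> (\<Union>i. A i)" "\<And>i. bounded (A i)"
        and ltA: "(\<Sum>i. ennreal ((diameter (A i))\<^sup>2)) < ennreal (e/4)"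
    using S \<open>e / 4 > 0\<close> unfolding hausdorff_measure_2_zero_iff by meson
  obtain B :: "nat \<Rightarrow> 'a set" where B: "T \<subseteq> (\<Union>i. B i)" "\<And>i. bounded (B i)"
        and ltB: "(\<Sum>i. ennreal ((diameter (B i))\<^sup>2)) < ennreal (e/4)"
    using T \<open>e / 4 > 0\<close> unfolding hausdorff_measure_2_zero_iff by meson
  define E where "E i = (if even i then A (i div 2) else B (i div 2))" for i
  let ?d = "\<lambda>A. ennreal ((diameter (A :: 'a set))\<^sup>2)"
  have "S \<union> T \<subseteq> (\<Union>i. E i)"
  proof
    fix x assume "x \<in> S \<union> T"
    then obtain i where "x \<in> A i \<or> x \<in> B i" using A(1) B(1) by blast
    then have "x \<in> E (2 * i) \<or> x \<in> E (2 * i + 1)" by (auto simp: E_def)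
    then show "x \<in> (\<Union>i. E i)" by blast
  qed
  moreover have "bounded (E i)" for i using A(2) B(2) by (simp add: E_def)
  moreover have "(\<Sum>i. ?d (E i)) < ennreal e"
  proof -
    have split: "(\<Sum>i<2*n. ?d (E i)) = (\<Sum>i<n. ?d (A i)) + (\<Sum>i<n. ?d (B i))" for n
    proof (induction n)
      case (Suc n)
      have "(\<Sum>i<2*Suc n. ?d (E i)) = (\<Sum>i<2*n. ?d (E i)) + ?d (E (2*n)) + ?d (E (2*n+1))"
        by simp
      also have "\<dots> = (\<Sum>i<2*n. ?d (E i)) + ?d (A n) + ?d (B n)"
        by (simp add: E_def)
      finally show ?case unfolding Suc by (simp add: ac_simps)
    qed simp
    have "(\<Sum>i<n. ?d (E i)) \<le> ennreal (e/4) + ennreal (e/4)" for n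
    proof -
      have "(\<Sum>i<n. ?d (E i)) \<le> (\<Sum>i<2*n. ?d (E i))"
        by (intro sum_mono2) auto
      also have "\<dots> \<le> (\<Sum>i. ?d (A i)) + (\<Sum>i. ?d (B i))"
        unfolding split by (intro add_mono sum_le_suminf) auto
      also have "\<dots> \<le> ennreal (e/4) + ennreal (e/4)"
        using ltA ltB by (intro add_mono) auto
      finally show ?thesis .
    qed
    then have "(\<Sum>i. ?d (E i)) \<le> ennreal (e/4) + ennreal (e/4)"
      unfolding suminf_eq_SUP by (intro SUP_least) auto
    also have "\<dots> < ennreal e"
      using \<open>e > 0\<close> ennreal_plus[of "e/4" "e/4"] ennreal_less_iff[of "e/4+e/4" e] by simp
    finally show ?thesis .
  qed
  ultimately show "\<exists>E :: nat \<Rightarrow> 'a set. S \<union> T \<subseteq> (\<Union>i. E i) \<and> (\<forall>i. bounded (E i)) \<and>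
       (\<Sum>i. ennreal ((diameter (E i))\<^sup>2)) < ennreal e" by blast
qed

text \<open>\<open>dist p\<close> is 1-Lipschitz. The interval turns a covering set into a set of
  radii, or of distances, whose length is its diameter.\<close>

lemma dist_image_in_interval:
  fixes E :: "'a::metric_space set"
  assumes "bounded E"
  obtains a where "\<And>x. x \<in> E \<Longrightarrow> dist p x \<in> {a..a + diameter E}"
proof -
  let ?a = "Inf (dist p ` E)"
  have bdd: "bdd_below (dist p ` E)" by (intro bdd_belowI[of _ 0]) auto
  have "dist p x \<in> {?a..?a + diameter E}" if "x \<in> E" for x
  proof -
    have "?a \<le> dist p x" using that bdd by (intro cInf_lower) auto
    moreover have "dist p x - diameter E \<le> ?a"
    proof (rule cInf_greatest)
      show "dist p ` E \<noteq> {}" using that by auto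
      fix y assume "y \<in> dist p ` E"
      then obtain z where z: "z \<in> E" "y = dist p z" by auto
      have "dist x z \<le> diameter E"
        using assms diameter_bounded_bound that z(1) by blast
      then show "dist p x - diameter E \<le> y" using z dist_triangle[of p x z] by (simp add: dist_commute)
    qed
    ultimately show ?thesis by auto
  qed
  then show ?thesis using that by blast
qed

text \<open>Eilenberg's inequality for the distance function, in the degenerate case: almost every
  sphere meets an \<open>H\<^sup>2\<close>-null set in an \<open>H\<^sup>1\<close>-null set, which is totally disconnected.\<close>

lemma null_generic_sphere_totally_disconnected:
  fixes S :: "'a::metric_space set"
  assumes S: "hausdorff_measure 2 S = 0" and "r0 > 0"
  obtains r where "0 < r" "r < r0"
    "\<forall>K\<subseteq>S. connected K \<longrightarrow> (\<forall>z\<in>K. dist p z = r) \<longrightarrow> (\<forall>x\<in>K. \<forall>y\<in>K. x = y)"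
proof -
  \<comment> \<open>Bad radii: some connected piece of \<open>S\<close> on the sphere has two points
    more than \<open>\<delta>\<close> apart. Each \<open>B \<delta>\<close> is negligible, and
    countably many \<open>\<delta>\<close> catch all nondegenerate pieces.\<close>
  define B where "B \<delta> = {r. \<exists>K x y. connected K \<and> K \<subseteq> S \<and> (\<forall>z\<in>K. dist p z = r) \<and>
      x \<in> K \<and> y \<in> K \<and> \<delta> < dist x y}" for \<delta> :: real
  have neg: "negligible (B \<delta>)" if "\<delta> > 0" for \<delta>
    unfolding negligible_outer_le
  proof (intro allI impI)
    fix e :: real assume "e > 0"
    then have "e * \<delta> > 0" using \<open>\<delta> > 0\<close> by simp
    then obtain E :: "nat \<Rightarrow> 'a set" where E: "S \<subseteq> (\<Union>i. E i)" "\<And>i. bounded (E i)"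
        and lt: "(\<Sum>i. ennreal ((diameter (E i))\<^sup>2)) < ennreal (e * \<delta>)"
      using S unfolding hausdorff_measure_2_zero_iff by meson
    have "\<exists>a. \<forall>x\<in>E i. dist p x \<in> {a..a + diameter (E i)}" for i
      using dist_image_in_interval[OF E(2)] by metis
    then obtain a where a: "\<And>i x. x \<in> E i \<Longrightarrow> dist p x \<in> {a i..a i + diameter (E i)}"
      by metis
    define I where "I i = {a i..a i + diameter (E i)}" for i
    \<comment> \<open>The total diameter of the covering sets that can meet the sphere of radius
      \<open>r\<close>. Each set contributes its diameter over an interval of the same length, so
      the integral is the sum of the squared diameters, and Markov's inequality at level
      \<open>\<delta>\<close> leaves measure at most \<open>e\<close>.\<close>
    define \<phi> where "\<phi> r = (\<Sum>i. ennreal (diameter (E i)) * indicator (I i) r)" for r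
    have [measurable]: "\<phi> \<in> borel_measurable lborel" unfolding \<phi>_def I_def by measurable
    have d0: "0 \<le> diameter (E i)" for i using E(2) by (rule diameter_ge_0)
    have int: "(\<integral>\<^sup>+r. \<phi> r \<partial>lborel) = (\<Sum>i. ennreal ((diameter (E i))\<^sup>2))"
      unfolding \<phi>_def I_def
      by (subst nn_integral_suminf)
         (auto simp: nn_integral_cmult_indicator d0 ennreal_mult'[symmetric] power2_eq_square)
    define T where "T = {r. 1 \<le> ennreal (1/\<delta>) * \<phi> r}"
    have Tm: "T \<in> sets lborel" unfolding T_def by measurable
    have "emeasure lborel T \<le> ennreal (1/\<delta>) * (\<integral>\<^sup>+r. \<phi> r \<partial>lborel)"
      using nn_integral_Markov_inequality[of \<phi> UNIV lborel "ennreal (1/\<delta>)"]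
      by (simp add: T_def)
    also have "\<dots> \<le> ennreal (1/\<delta>) * ennreal (e * \<delta>)"
      unfolding int using lt by (intro mult_left_mono) auto
    also have "\<dots> = ennreal e"
      using \<open>\<delta> > 0\<close> \<open>e > 0\<close> by (simp add: ennreal_mult'[symmetric])
    finally have Te: "emeasure lborel T \<le> ennreal e" .
    have "B \<delta> \<subseteq> T"
    proof
      fix r assume "r \<in> B \<delta>"
      then obtain K x y where K: "connected K" "K \<subseteq> S" "\<And>z. z \<in> K \<Longrightarrow> dist p z = r"
        "x \<in> K" "y \<in> K" "\<delta> < dist x y" unfolding B_def by blast
      have "\<exists>b. \<forall>z\<in>E i. dist x z \<in> {b..b + diameter (E i)}" for i
        using dist_image_in_interval[OF E(2)] by metis
      then obtain b where b: "\<And>i z. z \<in> E i \<Longrightarrow> dist x z \<in> {b i..b i + diameter (E i)}"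
        by metis
      \<comment> \<open>The image of \<open>K\<close> under \<open>dist x\<close> contains an
        interval longer than \<open>\<delta>\<close>, covered by one interval \<open>J i\<close> for
        each covering set that meets \<open>K\<close>. Hence a bad radius has
        \<open>\<phi> r \<ge> \<delta>\<close>.\<close>
      define J where "J i = (if E i \<inter> K = {} then {} else {b i..b i + diameter (E i)})" for i
      have "connected (dist x ` K)"
        using K(1) by (intro connected_continuous_image continuous_intros)
      then have "{0..dist x y} \<subseteq> dist x ` K"
        using connected_contains_Icc[of "dist x ` K" 0 "dist x y"] K(4,5)
        by (metis dist_self imageI)
      also have "\<dots> \<subseteq> (\<Union>i. J i)"
      proof
        fix t assume "t \<in> dist x ` K"
        then obtain z where z: "z \<in> K" "t = dist x z" by auto
        then obtain i where "z \<in> E i" using K(2) E(1) by blast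
        then show "t \<in> (\<Union>i. J i)" using b[of z i] z unfolding J_def by auto
      qed
      finally have sub: "{0..dist x y} \<subseteq> (\<Union>i. J i)" .
      have Jm: "J i \<in> sets lborel" for i by (simp add: J_def)
      have "ennreal \<delta> \<le> emeasure lborel {0..dist x y}" using K(6) by (simp add: ennreal_leI)
      also have "\<dots> \<le> emeasure lborel (\<Union>i. J i)"
        using sub Jm by (intro emeasure_mono) auto
      also have "\<dots> \<le> (\<Sum>i. emeasure lborel (J i))"
        using Jm by (intro emeasure_subadditive_countably) auto
      also have "\<dots> \<le> \<phi> r"
        unfolding \<phi>_def
      proof (intro suminf_le allI)
        fix i
        show "emeasure lborel (J i) \<le> ennreal (diameter (E i)) * indicator (I i) r"
        proof (cases "E i \<inter> K = {}")
          case False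
          then obtain z where "z \<in> E i" "z \<in> K" by auto
          then have "r \<in> I i" using a[of z i] K(3)[of z] by (auto simp: I_def)
          then show ?thesis using False d0[of i] by (simp add: J_def)
        qed (simp add: J_def)
      qed auto
      finally have "ennreal (1/\<delta>) * ennreal \<delta> \<le> ennreal (1/\<delta>) * \<phi> r"
        by (intro mult_left_mono) auto
      then show "r \<in> T" using \<open>\<delta> > 0\<close> by (simp add: T_def ennreal_mult'[symmetric])
    qed
    moreover have "T \<in> lmeasurable"
    proof (rule fmeasurableI)
      show "emeasure lebesgue T < \<infinity>"
        using Tm le_less_trans[OF Te ennreal_less_top] by simp
    qed (use Tm in simp)
    moreover have "measure lebesgue T \<le> e"
      using Te Tm \<open>e > 0\<close> by (simp add: measure_def enn2real_leI)
    ultimately show "\<exists>T. B \<delta> \<subseteq> T \<and> T \<in> lmeasurable \<and> measure lebesgue T \<le> e" by blast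
  qed
  have "negligible (\<Union>n. B (inverse (real (Suc n))))"
    by (intro negligible_countable_Union) (auto intro!: neg)
  moreover have "\<not> negligible {0<..<r0}"
    using open_not_negligible[of "{0<..<r0}"] \<open>r0 > 0\<close> by auto
  ultimately obtain r where r: "r \<in> {0<..<r0}" "r \<notin> (\<Union>n. B (inverse (real (Suc n))))"
    using negligible_subset by blast
  have "x = y" if "connected K" "K \<subseteq> S" "\<And>z. z \<in> K \<Longrightarrow> dist p z = r" "x \<in> K" "y \<in> K" for K x y
  proof (rule ccontr)
    assume "x \<noteq> y"
    then obtain n where "inverse (real (Suc n)) < dist x y"
      using reals_Archimedean[of "dist x y"] by auto
    then have "r \<in> B (inverse (real (Suc n)))" unfolding B_def using that by blast
    with r(2) show False by blast
  qed
  then show ?thesis using that[of r] r(1) by auto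
qed

section \<open>Null homotopies of loops in null sets\<close>

lemma interlacing_paths_meet:
  fixes f g :: "real \<Rightarrow> real \<times> real"
  assumes f: "path f" "pathstart f = (0, a)" "pathfinish f = (0, b)"
    and g: "path g" "pathstart g = (0, c)" "pathfinish g = (0, d)"
    and f0: "\<And>z. z \<in> path_image f \<Longrightarrow> 0 \<le> fst z" and g0: "\<And>z. z \<in> path_image g \<Longrightarrow> 0 \<le> fst z"
    and "a < c" "c < b" "b < d"
  shows "path_image f \<inter> path_image g \<noteq> {}"
proof -
  \<comment> \<open>Exchanging the coordinates carries the boundary line to the bottom edge of a
    box, where \<open>fashoda_interlace\<close> expects the four interlacing endpoints.\<close>
  define T :: "real \<times> real \<Rightarrow> real^2" where "T z = (\<chi> i. if i = 1 then snd z else fst z)" for z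
  have T1: "T z $ 1 = snd z" and T2: "T z $ 2 = fst z" for z by (simp_all add: T_def)
  have contT: "continuous_on A T" for A
    unfolding T_def
  proof (rule continuous_on_vec_lambda)
    show "continuous_on A (\<lambda>z. if i = 1 then snd z else fst z)" for i :: 2
      by (cases "i = 1") (auto intro!: continuous_intros)
  qed
  have inj: "T z = T w \<Longrightarrow> z = w" for z w by (metis T1 T2 prod.expand)
  have "compact (path_image f \<union> path_image g)"
    using f(1) g(1) by (intro compact_Un compact_path_image)
  then obtain B where B: "\<And>z. z \<in> path_image f \<union> path_image g \<Longrightarrow> norm z \<le> B"
    using compact_imp_bounded bounded_iff by metis
  have box: "T z \<in> cbox (vector [-B, 0]) (vector [B, B])" if "z \<in> path_image f \<union> path_image g" for z
  proof -
    have "\<bar>fst z\<bar> \<le> norm z" "\<bar>snd z\<bar> \<le> norm z"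
      using norm_fst_le[of "fst z" "snd z"] norm_snd_le[of "snd z" "fst z"] by simp_all
    then have "\<bar>fst z\<bar> \<le> B" "\<bar>snd z\<bar> \<le> B" using B[OF that] by auto
    moreover have "0 \<le> fst z" using that f0 g0 by blast
    ultimately show ?thesis by (simp add: mem_box_cart forall_2 T1 T2 abs_le_iff)
  qed
  have "path (T \<circ> f)" "path (T \<circ> g)"
    using f(1) g(1) contT by (auto intro: path_continuous_image)
  moreover have "path_image (T \<circ> f) \<subseteq> cbox (vector [-B, 0]) (vector [B, B])"
    "path_image (T \<circ> g) \<subseteq> cbox (vector [-B, 0]) (vector [B, B])"
    using box by (auto simp: path_image_compose)
  ultimately obtain z where "z \<in> path_image (T \<circ> f)" "z \<in> path_image (T \<circ> g)"
    using fashoda_interlace[of "T \<circ> f" "T \<circ> g" "vector [-B, 0]" "vector [B, B]"]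
    by (auto simp: pathstart_compose pathfinish_compose T1 T2 f g assms(9-11))
  then obtain z1 z2 where "z1 \<in> path_image f" "z2 \<in> path_image g" "T z1 = T z2"
    unfolding path_image_compose by force
  then show ?thesis using inj by blast
qed

definition fold_half :: "real \<times> real \<Rightarrow> real \<times> real" where
  "fold_half z = (\<bar>fst z\<bar>, snd z)"

lemma continuous_on_fold_half: "continuous_on A fold_half"
  unfolding fold_half_def by (intro continuous_intros)

text \<open>A continuum need not be path connected, but its open
  \<open>\<delta>\<close>-neighbourhood is. The path found there may leave the half-plane; folding
  it back does not increase the distance to any point of \<open>K\<close>, so it still misses
  \<open>C\<close>.\<close>

lemma path_near_connected:
  fixes K C :: "(real \<times> real) set"
  assumes K: "connected K" "compact K" "\<And>z. z \<in> K \<Longrightarrow> 0 \<le> fst z"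
    and C: "closed C" "K \<inter> C = {}" and ab: "a \<in> K" "b \<in> K"
  obtains f where "path f" "pathstart f = a" "pathfinish f = b" "path_image f \<inter> C = {}"
    "\<And>z. z \<in> path_image f \<Longrightarrow> 0 \<le> fst z"
proof -
  obtain \<delta> where \<delta>: "\<delta> > 0" "\<And>x y. x \<in> K \<Longrightarrow> y \<in> C \<Longrightarrow> \<delta> \<le> dist x y"
    using separate_compact_closed[OF K(2) C] by blast
  define N where "N = (\<Union>k\<in>K. ball k \<delta>)"
  \<comment> \<open>Written as a Minkowski sum, the neighbourhood is a continuous image of a
    connected product.\<close>
  have "N = (\<lambda>(x, y). x + y) ` (K \<times> ball 0 \<delta>)"
  proof (intro equalityI subsetI)
    fix z assume "z \<in> N"
    then obtain k where k: "k \<in> K" "dist k z < \<delta>" by (auto simp: N_def)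
    then have "z = (\<lambda>(x, y). x + y) (k, z - k)" "(k, z - k) \<in> K \<times> ball 0 \<delta>"
      by (auto simp: dist_norm norm_minus_commute)
    then show "z \<in> (\<lambda>(x, y). x + y) ` (K \<times> ball 0 \<delta>)" by blast
  next
    fix z assume "z \<in> (\<lambda>(x, y). x + y) ` (K \<times> ball 0 \<delta>)"
    then obtain k w where "k \<in> K" "norm w < \<delta>" "z = k + w" by auto
    then show "z \<in> N" unfolding N_def by (intro UN_I[of k]) (auto simp: dist_norm)
  qed
  moreover have "connected (K \<times> ball (0::real\<times>real) \<delta>)" using K(1) by (intro connected_Times) auto
  ultimately have "connected N"
    by (auto intro!: connected_continuous_image continuous_intros simp: case_prod_unfold)
  moreover have "open N" unfolding N_def by auto
  ultimately have "path_connected N" by (rule connected_open_path_connected[rotated])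
  moreover have "a \<in> N" "b \<in> N" using ab \<delta>(1) unfolding N_def by (meson UN_I centre_in_ball)+
  ultimately obtain q where q: "path q" "path_image q \<subseteq> N" "pathstart q = a" "pathfinish q = b"
    unfolding path_connected_def by blast
  have contract: "dist k (fold_half z) \<le> dist k z" if "k \<in> K" for k z
  proof -
    have "\<bar>fst k - \<bar>fst z\<bar>\<bar> \<le> \<bar>fst k - fst z\<bar>" using K(3)[OF that] by linarith
    then show ?thesis
      unfolding dist_prod_def fold_half_def
      by (intro real_sqrt_le_mono add_mono power_mono) (auto simp: dist_real_def)
  qed
  have "fold_half z \<notin> C" if "z \<in> N" for z
  proof
    assume "fold_half z \<in> C"
    obtain k where k: "k \<in> K" "dist k z < \<delta>" using \<open>z \<in> N\<close> unfolding N_def by (meson UN_E mem_ball)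
    have "\<delta> \<le> dist k (fold_half z)" by (rule \<delta>(2)[OF k(1) \<open>fold_half z \<in> C\<close>])
    also have "\<dots> < \<delta>" using contract[OF k(1)] k(2) by (rule le_less_trans)
    finally show False by simp
  qed
  then have disj: "path_image (fold_half \<circ> q) \<inter> C = {}"
    using q(2) unfolding path_image_compose by blast
  have "fold_half k = k" if "k \<in> K" for k
    using K(3)[OF that] by (simp add: fold_half_def prod_eq_iff)
  then have ends: "pathstart (fold_half \<circ> q) = a" "pathfinish (fold_half \<circ> q) = b"
    using q(3,4) ab by (simp_all add: pathstart_compose pathfinish_compose)
  have "path (fold_half \<circ> q)"
    using q(1) by (intro path_continuous_image continuous_on_fold_half)
  moreover have "0 \<le> fst z" if "z \<in> path_image (fold_half \<circ> q)" for z
    using that unfolding path_image_compose fold_half_def by force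
  ultimately show ?thesis by (intro that[OF _ ends disj])
qed

text \<open>Were they disjoint, they could be replaced by paths in turn: the first avoids
  \<open>K'\<close>, the second avoids the first.\<close>

lemma interlacing_continua_meet:
  fixes K K' :: "(real \<times> real) set"
  assumes K: "connected K" "compact K" "\<And>z. z \<in> K \<Longrightarrow> 0 \<le> fst z"
    and K': "connected K'" "compact K'" "\<And>z. z \<in> K' \<Longrightarrow> 0 \<le> fst z"
    and in_K: "(0, a) \<in> K" "(0, b) \<in> K" and in_K': "(0, c) \<in> K'" "(0, d) \<in> K'"
    and less: "a < c" "c < b" "b < d"
  shows "K \<inter> K' \<noteq> {}"
proof
  assume "K \<inter> K' = {}"
  then obtain f where f: "path f" "pathstart f = (0, a)" "pathfinish f = (0, b)"
      "path_image f \<inter> K' = {}" "\<And>z. z \<in> path_image f \<Longrightarrow> 0 \<le> fst z"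
    using path_near_connected[OF K compact_imp_closed[OF K'(2)] _ in_K] by blast
  have "K' \<inter> path_image f = {}" using f(4) by blast
  then obtain g where g: "path g" "pathstart g = (0, c)" "pathfinish g = (0, d)"
      "path_image g \<inter> path_image f = {}" "\<And>z. z \<in> path_image g \<Longrightarrow> 0 \<le> fst z"
    using path_near_connected[OF K' closed_path_image[OF f(1)] _ in_K'] by blast
  show False
    using interlacing_paths_meet[OF f(1-3) g(1-3) f(5) g(5) less] g(4) by blast
qed

text \<open>A null homotopy of a loop, extended to the plane: the loop runs along the segment from
  \<open>(0, 0)\<close> to \<open>(0, 1)\<close>, the second half-plane is a mirror image of the first, and the map is
  constant outside a rectangle.\<close>

locale folded_disc =
  fixes F :: "real \<times> real \<Rightarrow> 'a::metric_space" and p :: 'a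
  assumes contF: "continuous_on UNIV F"
    and mirror: "F (- v, x) = F (v, x)"
    and outer: "\<not> (\<bar>v\<bar> < 1 \<and> 0 < x \<and> x < 1) \<Longrightarrow> F (v, x) = p"
    and null: "hausdorff_measure 2 (range F) = 0"
begin

text \<open>The witness may be any connected set, even unbounded or on both sides of the segment,
  which makes links easy to produce; \<open>linked_continuum\<close> brings it into normal
  form.\<close>

definition linked :: "real \<Rightarrow> real \<Rightarrow> bool" where
  "linked x y \<longleftrightarrow> (\<exists>K. connected K \<and> (0, x) \<in> K \<and> (0, y) \<in> K \<and> (\<forall>z\<in>K. F z = F (0, x)))"

definition outside :: "(real \<times> real) set" where
  "outside = - ({-1<..<1} \<times> {0<..<1})"

lemma F_outside: "z \<in> outside \<Longrightarrow> F z = p"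
  unfolding outside_def by (cases z) (use outer in auto)

lemma connected_outside: "connected outside"
  unfolding outside_def
  by (intro connected_complement_bounded_convex bounded_Times convex_Times) auto

lemma closed_outside: "closed outside"
  unfolding outside_def by (intro closed_Compl open_Times) auto

lemma F_abs: "F (\<bar>v\<bar>, x) = F (v, x)"
  by (cases "v \<ge> 0") (auto simp: mirror)

text \<open>\<open>F\<close> is invariant under folding and clamping to the unit square, since
  points outside the open rectangle stay outside it and have value \<open>p\<close>. The image of a
  level set thus keeps its level, and by continuity so does the closure.\<close>

lemma linked_continuum:
  assumes "linked x y" "x \<in> {0..1}" "y \<in> {0..1}"
  obtains K where "connected K" "compact K" "K \<subseteq> {0..1} \<times> {0..1}" "(0, x) \<in> K" "(0, y) \<in> K"
    "\<And>z. z \<in> K \<Longrightarrow> F z = F (0, x)"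
proof -
  define \<rho> :: "real \<times> real \<Rightarrow> real \<times> real" where
    "\<rho> z = (min 1 \<bar>fst z\<bar>, max 0 (min 1 (snd z)))" for z
  have cont\<rho>: "continuous_on A \<rho>" for A unfolding \<rho>_def by (intro continuous_intros)
  have F\<rho>: "F (\<rho> z) = F z" for z
  proof (cases "\<bar>fst z\<bar> < 1 \<and> 0 < snd z \<and> snd z < 1")
    case True
    then have "\<rho> z = (\<bar>fst z\<bar>, snd z)" by (auto simp: \<rho>_def)
    then show ?thesis by (simp add: F_abs)
  next
    case False
    then have "\<not> (\<bar>fst (\<rho> z)\<bar> < 1 \<and> 0 < snd (\<rho> z) \<and> snd (\<rho> z) < 1)" by (auto simp: \<rho>_def)
    then show ?thesis using False outer by (metis prod.collapse)
  qed
  obtain K where K: "connected K" "(0, x) \<in> K" "(0, y) \<in> K" "\<And>z. z \<in> K \<Longrightarrow> F z = F (0, x)"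
    using assms(1) unfolding linked_def by blast
  let ?K = "closure (\<rho> ` K)"
  have "\<rho> ` K \<subseteq> {0..1} \<times> {0..1}" by (auto simp: \<rho>_def)
  then have sub: "?K \<subseteq> {0..1} \<times> {0..1}" by (intro closure_minimal closed_Times) auto
  moreover have "compact ?K"
    using sub bounded_subset[OF bounded_Times[of "{0..1::real}" "{0..1::real}"]]
    by (auto simp: compact_eq_bounded_closed)
  moreover have "connected ?K"
    using K(1) cont\<rho> by (intro connected_imp_connected_closure connected_continuous_image)
  moreover have "\<rho> (0, x) = (0, x)" "\<rho> (0, y) = (0, y)" using assms by (auto simp: \<rho>_def)
  then have "(0, x) \<in> ?K" "(0, y) \<in> ?K"
    using K(2,3) closure_subset by (metis image_eqI subsetD)+
  moreover have "F z = F (0, x)" if "z \<in> ?K" for z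
  proof -
    have "closed {z. F z = F (0, x)}"
      by (intro closed_Collect_eq contF continuous_on_const)
    moreover have "\<rho> ` K \<subseteq> {z. F z = F (0, x)}" using K(4) F\<rho> by auto
    ultimately show ?thesis using that closure_minimal by blast
  qed
  ultimately show ?thesis using that by blast
qed

text \<open>The two continua cross in the half-plane, so their levels agree and their union is one
  link.\<close>

lemma linked_interlacing:
  assumes "linked x y" "linked x' y'" "0 \<le> x" "x < x'" "x' < y" "y < y'" "y' \<le> 1"
  shows "linked x y'"
proof -
  obtain K where K: "connected K" "compact K" "K \<subseteq> {0..1} \<times> {0..1}" "(0, x) \<in> K" "(0, y) \<in> K"
    "\<And>z. z \<in> K \<Longrightarrow> F z = F (0, x)" using linked_continuum[of x y] assms by auto
  obtain K' where K': "connected K'" "compact K'" "K' \<subseteq> {0..1} \<times> {0..1}" "(0, x') \<in> K'" "(0, y') \<in> K'"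
    "\<And>z. z \<in> K' \<Longrightarrow> F z = F (0, x')" using linked_continuum[of x' y'] assms by auto
  have "K \<inter> K' \<noteq> {}"
    by (rule interlacing_continua_meet[OF K(1,2) _ K'(1,2) _ K(4,5) K'(4,5)])
      (use K(3) K'(3) assms in auto)
  then obtain z where z: "z \<in> K" "z \<in> K'" by blast
  then have "F (0, x') = F (0, x)" using K(6) K'(6) by metis
  then have "\<forall>w\<in>K \<union> K'. F w = F (0, x)" using K(6) K'(6) by auto
  moreover have "connected (K \<union> K')" using K(1) K'(1) z by (intro connected_Un) auto
  ultimately show ?thesis
    unfolding linked_def using K(4) K'(5) by blast
qed

text \<open>Cutting the disc along a linking continuum \<open>K\<close> and filling the part that does not border
  the segment from \<open>x\<close> to \<open>y\<close> with a constant.\<close>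

lemma linked_imp_nullhomotopic:
  assumes "linked x y" "0 \<le> x" "x < y" "y \<le> 1"
  shows "homotopic_paths (range F) (\<lambda>t. F (0, x + t * (y - x))) (\<lambda>_. F (0, x))"
proof -
  obtain K where K: "connected K" "compact K" "K \<subseteq> {0..1} \<times> {0..1}" "(0, x) \<in> K" "(0, y) \<in> K"
    "\<And>z. z \<in> K \<Longrightarrow> F z = F (0, x)" using linked_continuum[of x y] assms by auto
  let ?q = "F (0, x)"
  \<comment> \<open>After symmetrising, a path off \<open>M\<close> folds to a path off
    \<open>K\<close>, so crossing in the half-plane applies.\<close>
  define M where "M = K \<union> (\<lambda>z. (- fst z, snd z)) ` K"
  have "compact M" unfolding M_def
    using K(2) by (intro compact_Un compact_continuous_image continuous_intros)
  then have "closed M" by (rule compact_imp_closed)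
  have FM: "F z = ?q" if "z \<in> M" for z
  proof -
    obtain w where "w \<in> K" "z = w \<or> z = (- fst w, snd w)" using \<open>z \<in> M\<close> unfolding M_def by blast
    then show ?thesis using K(6)[of w] mirror[of "fst w" "snd w"] by auto
  qed
  have M_fold: "z \<in> M" if "fold_half z \<in> K" for z
  proof (cases "fst z \<ge> 0")
    case True
    then show ?thesis using that by (simp add: M_def fold_half_def)
  next
    case False
    then have "z = (\<lambda>z. (- fst z, snd z)) (fold_half z)" by (simp add: fold_half_def)
    then show ?thesis using that unfolding M_def by blast
  qed
  \<comment> \<open>The components of the complement of \<open>M\<close> that border the open
    segment from \<open>x\<close> to \<open>y\<close>; on these \<open>F\<close> is kept.\<close>
  define U where "U = {z. \<exists>e. x < e \<and> e < y \<and> connected_component (- M) (0, e) z}"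
  have "U = (\<Union>e\<in>{x<..<y}. connected_component_set (- M) (0, e))" unfolding U_def by auto
  then have "open U"
    using \<open>closed M\<close> by (auto intro!: open_connected_component)
  have UM: "U \<subseteq> - M" unfolding U_def using connected_component_in by fastforce
  have line: "(0, s) \<notin> U" if "s \<notin> {x<..<y}" for s
  proof
    assume "(0, s) \<in> U"
    then obtain e where e: "x < e" "e < y" and cc: "connected_component (- M) (0, e) (0, s)"
      unfolding U_def by blast
    have "(0, s) \<notin> M" using cc connected_component_in by fastforce
    then have "s \<noteq> x" "s \<noteq> y" using K(4,5) unfolding M_def by auto
    have "open (- M)" using \<open>closed M\<close> by auto
    then have "path_component (- M) (0, e) (0, s)"
      using cc path_component_eq_connected_component_set[OF open_imp_locally_path_connected]
      by (metis mem_Collect_eq)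
    then obtain g where g: "path g" "path_image g \<subseteq> - M" "pathstart g = (0, e)" "pathfinish g = (0, s)"
      unfolding path_component_def by auto
    \<comment> \<open>A folded path from \<open>e\<close> to a point of the axis beyond
      \<open>x\<close> or \<open>y\<close> would interlace with \<open>K\<close>.\<close>
    let ?G = "fold_half ` path_image g"
    have "connected ?G" "compact ?G"
      using g(1) by (auto intro!: connected_continuous_image compact_continuous_image
          continuous_on_fold_half connected_path_image compact_path_image)
    moreover have "0 \<le> fst z" if "z \<in> ?G" for z using that by (auto simp: fold_half_def)
    moreover have "(0, e) \<in> ?G" "(0, s) \<in> ?G"
      using imageI[OF pathstart_in_path_image[of g], of fold_half]
        imageI[OF pathfinish_in_path_image[of g], of fold_half] g(3,4)
      by (simp_all add: fold_half_def)
    moreover have "?G \<inter> K = {}" using g(2) M_fold by blast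
    moreover have "0 \<le> fst z" if "z \<in> K" for z using that K(3) by auto
    ultimately show False
      using interlacing_continua_meet[of ?G K s e x y] interlacing_continua_meet[of K ?G x y e s]
        K e that \<open>s \<noteq> x\<close> \<open>s \<noteq> y\<close>
      by (metis Int_commute greaterThanLessThan_iff not_less_iff_gr_or_eq)
  qed
  \<comment> \<open>The exterior of the box is connected, misses \<open>M\<close> and contains a
    point of the axis below \<open>x\<close>, so it meets no kept component.\<close>
  have far: "z \<notin> U" if "z \<notin> {-1..1} \<times> {0..1}" for z
  proof
    assume "z \<in> U"
    then obtain e where e: "x < e" "e < y" and cc: "connected_component (- M) (0, e) z"
      unfolding U_def by blast
    have "connected (- ({-1..1::real} \<times> {0..1::real}))"
      by (intro connected_complement_bounded_convex bounded_Times convex_Times) auto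
    moreover have "- ({-1..1::real} \<times> {0..1::real}) \<subseteq> - M" using K(3) by (auto simp: M_def)
    ultimately have "connected_component (- M) z (0, -1)"
      using that unfolding connected_component_def
      by (intro exI[of _ "- ({-1..1::real} \<times> {0..1::real})"]) simp
    then have "connected_component (- M) (0, e) (0, -1)"
      using cc connected_component_trans by blast
    then have "(0, -1) \<in> U" using e unfolding U_def by blast
    then show False using line[of "-1"] assms by auto
  qed
  \<comment> \<open>Only points of \<open>M\<close> are critical for continuity, and there
    \<open>F\<close> already equals \<open>?q\<close>; elsewhere membership in \<open>U\<close> is
    locally constant.\<close>
  define F' where "F' z = (if z \<in> U then F z else ?q)" for z
  have "isCont F' z" for z
  proof -
    consider "z \<in> U" | "z \<in> M" | "z \<notin> U" "z \<notin> M" by blast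
    then show ?thesis
    proof cases
      case 1
      have "eventually (\<lambda>w. F' w = F w) (nhds z)"
        using eventually_nhds_in_open[OF \<open>open U\<close> 1] by eventually_elim (simp add: F'_def)
      moreover have "isCont F z" using contF continuous_on_eq_continuous_at[of UNIV F] by blast
      ultimately show ?thesis by (simp only: isCont_cong)
    next
      case 2
      have "isCont F z" using contF continuous_on_eq_continuous_at[of UNIV F] by blast
      moreover have "F' z = F z" using FM[OF 2] by (simp add: F'_def)
      moreover have "dist (F' w) (F z) \<le> dist (F w) (F z)" for w
        using FM[OF 2] by (simp add: F'_def)
      ultimately show ?thesis
        unfolding continuous_at_eps_delta by (metis le_less_trans)
    next
      case 3
      let ?W = "connected_component_set (- M) z"
      have "open ?W" using \<open>closed M\<close> by (intro open_connected_component) auto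
      moreover have "z \<in> ?W" using 3 by (simp add: connected_component_refl_eq)
      moreover have "w \<notin> U" if "w \<in> ?W" for w
        using that 3(1) connected_component_trans connected_component_sym unfolding U_def by blast
      ultimately have "eventually (\<lambda>w. F' w = ?q) (nhds z)"
        using eventually_nhds_in_open[of ?W z] by (auto elim!: eventually_mono simp: F'_def)
      then show ?thesis by (simp add: isCont_cong)
    qed
  qed
  then have contF': "continuous_on A F'" for A
    by (simp add: continuous_at_imp_continuous_on)
  \<comment> \<open>With \<open>fst z = v\<close> and \<open>snd z = t\<close>: at
    \<open>v = 0\<close> the curve is the segment from \<open>x\<close> to \<open>y\<close>; at
    \<open>v = 1\<close> it runs from \<open>(0, -1)\<close> to \<open>(0, 2)\<close> around the box
    on the right. While \<open>3 * t - 1\<close> is in \<open>[0, 1]\<close>,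
    \<open>t * (1 - t) \<ge> 1/9\<close>, so the factor 10 keeps the first coordinate above 1. That
    coordinate vanishes at \<open>t = 0\<close> and \<open>t = 1\<close>: the ends slide along the
    axis away from the open segment, where \<open>F'\<close> is constant.\<close>
  define g where "g z = (2 * min (fst z) (10 * snd z * (1 - snd z)),
      (1 - fst z) * (x + snd z * (y - x)) + fst z * (3 * snd z - 1))" for z :: "real \<times> real"
  have contg: "continuous_on A g" for A unfolding g_def by (intro continuous_intros)
  show ?thesis
    unfolding homotopic_paths
  proof (intro exI[of _ "F' \<circ> g"] conjI ballI)
    show "continuous_on ({0..1} \<times> {0..1}) (F' \<circ> g)"
      by (intro continuous_on_compose contg contF')
    show "F' \<circ> g \<in> {0..1} \<times> {0..1} \<rightarrow> range F" by (auto simp: F'_def)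
    show "(F' \<circ> g) (0, t) = F (0, x + t * (y - x))" if t: "t \<in> {0..1}" for t
    proof -
      have "0 \<le> t * (1 - t)" using t by (intro mult_nonneg_nonneg) auto
      then have g0: "g (0, t) = (0, x + t * (y - x))" by (simp add: g_def)
      show ?thesis
      proof (cases "(0, x + t * (y - x)) \<in> M \<or> (0, x + t * (y - x)) \<in> U")
        case True
        then show ?thesis using FM UM g0 by (auto simp: F'_def)
      next
        case False
        let ?e = "x + t * (y - x)"
        have "t \<noteq> 0" "t \<noteq> 1" using False K(4,5) by (auto simp: M_def)
        then have "0 < t" "t < 1" using t by auto
        then have "0 < t * (y - x)" "t * (y - x) < 1 * (y - x)"
          using assms by (simp, intro mult_strict_right_mono, auto)
        then have "x < ?e" "?e < y" by auto
        then have "(0, ?e) \<in> U"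
          using False unfolding U_def by (auto intro!: exI[of _ ?e] simp: connected_component_refl_eq)
        then show ?thesis using False by blast
      qed
    qed
    show "(F' \<circ> g) (1, t) = ?q" if t: "t \<in> {0..1}" for t
    proof -
      have "g (1, t) \<notin> {-1..1} \<times> {0..1}"
      proof
        assume "g (1, t) \<in> {-1..1} \<times> {0..1}"
        then have t': "1/3 \<le> t" "t \<le> 2/3" "2 * min 1 (10 * t * (1 - t)) \<le> 1" by (auto simp: g_def)
        then have "1/3 * (1/3) \<le> t * (1 - t)" by (intro mult_mono) auto
        then show False using t'(3) by (auto simp: min_def split: if_splits)
      qed
      then show ?thesis using far by (simp add: F'_def)
    qed
    fix v :: real assume v: "v \<in> {0..1}"
    have "(1 - v) * x - v \<le> x" "y \<le> (1 - v) * y + v * 2"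
    proof -
      have "0 \<le> v * x" using v assms by simp
      then show "(1 - v) * x - v \<le> x" using v by (simp add: algebra_simps)
      have "v * y \<le> v * 2" using v assms by (intro mult_left_mono) auto
      then show "y \<le> (1 - v) * y + v * 2" by (simp add: algebra_simps)
    qed
    moreover have "g (v, 0) = (0, (1 - v) * x - v)" "g (v, 1) = (0, (1 - v) * y + v * 2)"
      using v by (auto simp: g_def algebra_simps)
    ultimately have "F' (g (v, 0)) = ?q" "F' (g (v, 1)) = ?q"
      using line by (auto simp: F'_def)
    then show "pathstart (F' \<circ> g \<circ> Pair v) = pathstart (\<lambda>t. F (0, x + t * (y - x)))"
      "pathfinish (F' \<circ> g \<circ> Pair v) = pathfinish (\<lambda>t. F (0, x + t * (y - x)))"
      using K(5,6) by (auto simp: pathstart_def pathfinish_def)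
  qed
qed

text \<open>If the component \<open>Q\<close> of the level set through \<open>(0, x)\<close> reaches
  \<open>W\<close>, it yields a link beyond \<open>a\<close>. Otherwise a set at generic
  \<open>F\<close>-distance \<open>r\<close> from the value at \<open>x\<close> separates
  \<open>x\<close> from \<open>a\<close>; so does one of its components, on which \<open>F\<close>
  is constant and which crosses the axis on both sides of \<open>x\<close>.\<close>

lemma linked_dichotomy:
  assumes "0 < x" "x < a" "a \<le> 1"
  shows "(\<exists>y\<in>{a..1}. linked x y) \<or> (\<exists>a' b'. 0 < a' \<and> a' < x \<and> x < b' \<and> b' < a \<and> linked a' b')"
proof -
  let ?q = "F (0, x)"
  define Z where "Z = {z. F z = ?q}"
  define Q where "Q = connected_component_set Z (0, x)"
  \<comment> \<open>Two ways to link \<open>x\<close> beyond \<open>a\<close>: by meeting the axis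
    there, or through \<open>outside\<close>, which carries one value and contains
    \<open>(0, 1)\<close>.\<close>
  define W where "W = outside \<union> (Pair 0) ` {a..}"
  have "closed Z" unfolding Z_def by (intro closed_Collect_eq contF continuous_on_const)
  have Q: "connected Q" "(0, x) \<in> Q" "Q \<subseteq> Z"
    unfolding Q_def using connected_component_subset[of Z "(0, x)"]
    by (auto simp: connected_component_refl_eq Z_def)
  have ray: "Pair 0 ` {a..} = {0::real} \<times> {a..}" by auto
  have "closed W" unfolding W_def ray by (intro closed_Un closed_outside closed_Times) auto
  have "(0, 1) \<in> outside" by (auto simp: outside_def)
  have "connected W" unfolding W_def
  proof (rule connected_Un[OF connected_outside])
    show "connected (Pair (0::real) ` {a..})"
      unfolding ray using connected_Times[of "{0::real}" "{a..}"] by auto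
    show "outside \<inter> Pair 0 ` {a..} \<noteq> {}" using \<open>(0, 1) \<in> outside\<close> assms by auto
  qed
  have "(0, a) \<in> W" by (auto simp: W_def)
  have box: "z \<in> {-1..1} \<times> {0..1}" if "z \<notin> W" for z
  proof -
    have "z \<notin> outside" using that by (simp add: W_def)
    then show ?thesis by (cases z) (auto simp: outside_def)
  qed
  show ?thesis
  proof (cases "Q \<inter> W = {}")
    case False
    then obtain w where w: "w \<in> Q" "w \<in> W" by blast
    show ?thesis
    proof (cases "w \<in> outside")
      case True
      then have "F w = p" by (rule F_outside)
      then have "?q = p" using w(1) Q(3) by (auto simp: Z_def)
      then have "\<forall>z\<in>Q \<union> outside. F z = ?q" using Q(3) F_outside by (auto simp: Z_def)
      moreover have "connected (Q \<union> outside)"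
        using w True Q(1) connected_outside by (intro connected_Un) auto
      ultimately have "linked x 1"
        unfolding linked_def using Q(2) \<open>(0, 1) \<in> outside\<close> by blast
      then show ?thesis using assms(3) by auto
    next
      case False
      then obtain y where y: "w = (0, y)" "a \<le> y" using w(2) unfolding W_def by auto
      moreover have "y \<le> 1" using False y(1) by (auto simp: outside_def)
      moreover have "linked x y"
        unfolding linked_def using Q w(1) y(1) by (intro exI[of _ Q]) (auto simp: Z_def)
      ultimately show ?thesis by auto
    qed
  next
    case True
    then have "Q \<subseteq> {-1..1} \<times> {0..1}" using box by blast
    then have "bounded Q" by (rule bounded_subset[rotated]) (intro bounded_Times, auto)
    moreover have "closed Q" unfolding Q_def using \<open>closed Z\<close> by (rule closed_connected_component)
    ultimately have "compact Q" by (simp add: compact_eq_bounded_closed)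
    moreover have "Q \<in> components Z" using Q(2,3) unfolding Q_def by (intro componentsI) auto
    moreover have "locally compact Z" using \<open>closed Z\<close> by (rule closed_imp_locally_compact)
    moreover have "open (- W)" "Q \<subseteq> - W" using True \<open>closed W\<close> by auto
    \<comment> \<open>Other components of the level set may accumulate at \<open>Q\<close>, so
      \<open>Q\<close> is enlarged to a compact relatively clopen part of \<open>Z\<close> that
      still misses \<open>W\<close>; this has positive distance from the rest of
      \<open>Z\<close>.\<close>
    ultimately obtain K where K: "openin (top_of_set Z) K" "compact K" "Q \<subseteq> K" "K \<subseteq> - W"
      using Sura_Bura_clopen_subset[of Z Q "- W"] by metis
    have "closedin (top_of_set Z) (Z - K)" using K(1) by (intro closedin_diff) auto
    then have "closed (Z - K)" using \<open>closed Z\<close> closedin_closed_trans by blast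
    then have "closed (W \<union> (Z - K))" using \<open>closed W\<close> by blast
    then obtain \<delta> where \<delta>: "\<delta> > 0" "\<And>z w. z \<in> K \<Longrightarrow> w \<in> W \<union> (Z - K) \<Longrightarrow> \<delta> \<le> dist z w"
      using separate_compact_closed[OF K(2), of "W \<union> (Z - K)"] K(4) by blast
    have "(0, x) \<in> K" using Q(2) K(3) by blast
    then have "K \<noteq> {}" by blast
    define D where "D = {z. infdist z K \<le> \<delta> / 2}"
    have D: "z \<notin> W \<union> (Z - K)" if "z \<in> D" for z
    proof
      assume z: "z \<in> W \<union> (Z - K)"
      obtain k where k: "k \<in> K" "infdist z K = dist z k"
        using infdist_attains_inf[OF compact_imp_closed[OF K(2)] \<open>K \<noteq> {}\<close>] by blast
      then have "dist k z \<le> \<delta> / 2" using that by (simp add: D_def dist_commute)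
      then show False using \<delta>(2)[OF k(1) z] \<delta>(1) by simp
    qed
    have "closed D" unfolding D_def
      by (intro closed_Collect_le continuous_intros)
    have "D \<subseteq> {-1..1} \<times> {0..1}" using D box by blast
    then have "bounded D" by (rule bounded_subset[rotated]) (intro bounded_Times, auto)
    \<comment> \<open>This collar is disjoint from the level set, so by compactness \<open>u\<close>
      has a positive lower bound \<open>r0\<close> on it.\<close>
    define E where "E = {z. infdist z K = \<delta> / 2}"
    have "closed E" unfolding E_def by (intro closed_Collect_eq continuous_intros)
    moreover have "E \<subseteq> D" by (auto simp: E_def D_def)
    ultimately have "compact E" using \<open>bounded D\<close> bounded_subset by (auto simp: compact_eq_bounded_closed)
    define u where "u z = dist ?q (F z)" for z
    have contu: "continuous_on A u" for A
      unfolding u_def by (intro continuous_intros continuous_on_subset[OF contF]) auto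
    have "\<exists>r0>0. \<forall>z\<in>E. r0 \<le> u z"
    proof (cases "E = {}")
      case True
      then show ?thesis by (intro exI[of _ 1]) auto
    next
      case False
      then obtain z where z: "z \<in> E" "\<And>w. w \<in> E \<Longrightarrow> u z \<le> u w"
        using continuous_attains_inf[OF \<open>compact E\<close> False contu] by blast
      have "u z \<noteq> 0"
      proof
        assume "u z = 0"
        then have "z \<in> Z" by (simp add: u_def Z_def)
        then have "z \<in> K" using D[of z] \<open>E \<subseteq> D\<close> z(1) by blast
        then show False using z(1) \<delta>(1) by (simp add: E_def)
      qed
      then have "0 < u z" by (simp add: u_def)
      then show ?thesis using z(2) by blast
    qed
    then obtain r0 where r0: "r0 > 0" "\<And>z. z \<in> E \<Longrightarrow> r0 \<le> u z" by blast
    obtain r where r: "0 < r" "r < r0" 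
      and tot: "\<forall>K\<subseteq>range F. connected K \<longrightarrow> (\<forall>z\<in>K. dist ?q z = r) \<longrightarrow> (\<forall>y\<in>K. \<forall>z\<in>K. y = z)"
      using null_generic_sphere_totally_disconnected[OF null r0(1), of ?q] by blast
    define T where "T = D \<inter> {z. u z = r}"
    have "closed T" unfolding T_def
      by (intro closed_Int \<open>closed D\<close> closed_Collect_eq contu continuous_on_const)
    have "\<not> connected_component (- T) (0, x) (0, a)"
    proof
      assume "connected_component (- T) (0, x) (0, a)"
      then obtain C where C: "connected C" "C \<subseteq> - T" "(0, x) \<in> C" "(0, a) \<in> C"
        unfolding connected_component_def by blast
      \<comment> \<open>Passing from \<open>A\<close> to \<open>B\<close> requires
        \<open>u = r\<close> at a point of \<open>D\<close>, that is, a point of \<open>T\<close>: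
        on the collar \<open>u\<close> already exceeds \<open>r\<close>.\<close>
      define A where "A = {z. infdist z K < \<delta> / 2} \<inter> {z. u z < r}"
      define B where "B = - (D \<inter> {z. u z \<le> r})"
      have "open A" unfolding A_def
        by (intro open_Int open_Collect_less contu continuous_intros)
      moreover have "open B" unfolding B_def
        by (intro open_Compl closed_Int \<open>closed D\<close> closed_Collect_le contu continuous_on_const)
      moreover have "C \<subseteq> A \<union> B"
      proof
        fix z assume "z \<in> C"
        then have "z \<notin> T" using C(2) by blast
        moreover have "z \<notin> E \<or> r < u z" using r0(2)[of z] r(2) by force
        ultimately show "z \<in> A \<union> B" unfolding A_def B_def T_def D_def E_def by auto
      qed
      moreover have "A \<inter> B \<inter> C = {}" unfolding A_def B_def D_def by auto
      moreover have "(0, x) \<in> A" using \<open>(0, x) \<in> K\<close> \<delta>(1) r(1) by (simp add: A_def u_def)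
      moreover have "(0, a) \<in> B" using D[of "(0, a)"] \<open>(0, a) \<in> W\<close> by (auto simp: B_def)
      ultimately show False using connectedD[OF C(1)] C(3,4) by blast
    qed
    then obtain C where C: "C \<in> components T" and sep: "\<not> connected_component (- C) (0, x) (0, a)"
      using separation_by_component_closed_pointwise[OF \<open>closed T\<close>] by blast
    have "connected C" "C \<subseteq> T" using C in_components_connected in_components_subset by blast+
    have FC: "F y = F z" if "y \<in> C" "z \<in> C" for y z
    proof -
      have "connected (F ` C)"
        using \<open>connected C\<close> contF continuous_on_subset by (intro connected_continuous_image) auto
      moreover have "\<forall>w\<in>F ` C. dist ?q w = r"
        using \<open>C \<subseteq> T\<close> by (auto simp: T_def u_def)
      ultimately show ?thesis using tot that by blast
    qed
    have "C \<inter> W = {}" using \<open>C \<subseteq> T\<close> D by (auto simp: T_def)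
    have "(0, x) \<notin> C" using \<open>C \<subseteq> T\<close> r(1) by (auto simp: T_def u_def)
    obtain a' where a': "0 < a'" "a' < x" "(0, a') \<in> C"
    proof -
      \<comment> \<open>The axis below \<open>x\<close> together with \<open>W\<close> joins
        \<open>x\<close> to \<open>a\<close>. As \<open>C\<close> misses \<open>W\<close>, it must
        cross the axis below \<open>x\<close>.\<close>
      have "connected ({0} \<times> {0..x} \<union> W)"
      proof (rule connected_Un[OF _ \<open>connected W\<close>])
        show "connected ({0::real} \<times> {0..x})" by (intro connected_Times) auto
        have "(0, 0) \<in> {0} \<times> {0..x} \<inter> W" using assms by (auto simp: W_def outside_def)
        then show "{0} \<times> {0..x} \<inter> W \<noteq> {}" by blast
      qed
      moreover have "(0, x) \<in> {0} \<times> {0..x} \<union> W" using assms by auto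
      ultimately have "\<not> {0} \<times> {0..x} \<union> W \<subseteq> - C"
        using sep \<open>(0, a) \<in> W\<close> unfolding connected_component_def by blast
      then obtain s where s: "s \<in> {0..x}" "(0, s) \<in> C" using \<open>C \<inter> W = {}\<close> by blast
      moreover have "s \<noteq> x" using s(2) \<open>(0, x) \<notin> C\<close> by auto
      moreover have "(0, 0) \<in> W" by (auto simp: W_def outside_def)
      then have "s \<noteq> 0" using s(2) \<open>C \<inter> W = {}\<close> by auto
      ultimately show ?thesis using that[of s] by auto
    qed
    obtain b' where b': "x < b'" "b' < a" "(0, b') \<in> C"
    proof -
      have "connected ({0::real} \<times> {x..a})" by (intro connected_Times) auto
      moreover have "(0, x) \<in> {0} \<times> {x..a}" "(0, a) \<in> {0} \<times> {x..a}" using assms by auto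
      ultimately have "\<not> {0} \<times> {x..a} \<subseteq> - C"
        using sep unfolding connected_component_def by blast
      then obtain s where s: "s \<in> {x..a}" "(0, s) \<in> C" by blast
      moreover have "s \<noteq> x" using s(2) \<open>(0, x) \<notin> C\<close> by auto
      moreover have "s \<noteq> a" using s(2) \<open>C \<inter> W = {}\<close> \<open>(0, a) \<in> W\<close> by auto
      ultimately show ?thesis using that[of s] by auto
    qed
    have "linked a' b'"
      unfolding linked_def using \<open>connected C\<close> a'(3) b'(3) FC by blast
    then show ?thesis using a' b' by blast
  qed
qed

text \<open>If no point of \<open>{x1..x2}\<close> is linked beyond \<open>a\<close>, the links around the points of \<open>{x1..x2}\<close>
  merge into a single one, because interlacing links do.\<close>

lemma linked_interval:
  assumes "0 < x1" "x1 \<le> x2" "x2 < a" "a \<le> 1"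
  shows "(\<exists>z\<in>{x1..x2}. \<exists>y\<in>{a..1}. linked z y) \<or>
    (\<exists>a' b'. 0 < a' \<and> a' < x1 \<and> x2 < b' \<and> b' < a \<and> linked a' b')"
proof (rule ccontr)
  assume contra: "\<not> ?thesis"
  have around: "\<exists>a' b'. 0 < a' \<and> a' < x \<and> x < b' \<and> b' < a \<and> linked a' b'" if "x \<in> {x1..x2}" for x
    using linked_dichotomy[of x a] contra that assms by auto
  \<comment> \<open>Right ends of links that start below \<open>x1\<close>. The link around the
    point \<open>Sup Z\<close> ends beyond the supremum; it starts below \<open>x1\<close> itself,
    or interlaces with a link that does, so its right end is in \<open>Z\<close>.\<close>
  define Z where "Z = {b. x1 < b \<and> b < a \<and> (\<exists>a'. 0 < a' \<and> a' < x1 \<and> linked a' b)}"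
  have "Z \<noteq> {}" using around[of x1] assms unfolding Z_def by auto
  have bdd: "bdd_above Z" by (intro bdd_aboveI[of _ a]) (auto simp: Z_def)
  have Z_le: "b \<le> x2" if "b \<in> Z" for b
    using that contra unfolding Z_def by force
  have "Sup Z \<le> x2" using \<open>Z \<noteq> {}\<close> Z_le by (intro cSup_least) auto
  moreover have "x1 < Sup Z"
    using \<open>Z \<noteq> {}\<close> cSup_upper[OF _ bdd] by (force simp: Z_def)
  ultimately obtain a' b' where ab: "0 < a'" "a' < Sup Z" "Sup Z < b'" "b' < a" "linked a' b'"
    using around[of "Sup Z"] by auto
  obtain b where b: "b \<in> Z" "a' < b"
    using less_cSupD[OF \<open>Z \<noteq> {}\<close> ab(2)] by blast
  then obtain a'' where a'': "0 < a''" "a'' < x1" "linked a'' b" unfolding Z_def by blast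
  have "b < b'" using cSup_upper[OF b(1) bdd] ab(3) by simp
  have "b' \<in> Z"
  proof (cases "a' < x1")
    case True
    then show ?thesis using ab \<open>x1 < Sup Z\<close> unfolding Z_def by auto
  next
    case False
    then have "linked a'' b'"
      using linked_interlacing[OF a''(3) ab(5)] a'' b ab \<open>b < b'\<close> assms by auto
    then show ?thesis using a'' ab \<open>x1 < Sup Z\<close> unfolding Z_def by auto
  qed
  then show False using cSup_upper[OF _ bdd] ab(3) by force
qed

end

text \<open>Folding and clamping extend a null homotopy of \<open>\<omega>\<close> to a
  \<open>folded_disc\<close>, because the three sides other than the loop are mapped to the base
  point. Links then become arcs contractible in \<open>S\<close>.\<close>

lemma nullhomotopic_loop_pairing:
  fixes \<omega> :: "real \<Rightarrow> 'a::metric_space"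
  assumes hom: "homotopic_paths S \<omega> (\<lambda>_. \<omega> 0)" and S: "hausdorff_measure 2 S = 0"
    and x: "0 < x1" "x1 \<le> x2" "x2 < a" "a \<le> 1"
  defines "contractible_arc \<equiv> \<lambda>x y. homotopic_paths S (\<lambda>t. \<omega> (x + t * (y - x))) (\<lambda>_. \<omega> x)"
  shows "(\<exists>z\<in>{x1..x2}. \<exists>y\<in>{a..1}. contractible_arc z y) \<or>
    (\<exists>a' b'. 0 < a' \<and> a' < x1 \<and> x2 < b' \<and> b' < a \<and> contractible_arc a' b')"
proof -
  obtain h :: "real \<times> real \<Rightarrow> 'a"
    where h: "continuous_on ({0..1} \<times> {0..1}) h" "h \<in> ({0..1} \<times> {0..1}) \<rightarrow> S"
    and h_all: "\<forall>t\<in>{0..1}. h (0, t) = \<omega> t" "\<forall>t\<in>{0..1}. h (1, t) = \<omega> 0"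
      "\<forall>v\<in>{0..1}. h (v, 0) = \<omega> 0 \<and> h (v, 1) = \<omega> 1"
    using hom unfolding homotopic_paths pathstart_def pathfinish_def comp_def by blast
  note h = h h_all(1)[rule_format] h_all(2)[rule_format]
    h_all(3)[rule_format, THEN conjunct1] h_all(3)[rule_format, THEN conjunct2]
  have "\<omega> 1 = \<omega> 0" using h(4)[of 1] h(6)[of 1] by simp
  define \<rho> :: "real \<times> real \<Rightarrow> real \<times> real" where
    "\<rho> z = (min 1 \<bar>fst z\<bar>, max 0 (min 1 (snd z)))" for z
  define F where "F = h \<circ> \<rho>"
  have \<rho>: "\<rho> z \<in> {0..1} \<times> {0..1}" for z by (auto simp: \<rho>_def)
  have "range F \<subseteq> S" using \<rho> h(2) by (auto simp: F_def)
  interpret folded_disc F "\<omega> 0"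
  proof
    show "continuous_on UNIV F" unfolding F_def
    proof (rule continuous_on_compose)
      show "continuous_on UNIV \<rho>" unfolding \<rho>_def by (intro continuous_intros)
      show "continuous_on (range \<rho>) h" using \<rho> by (intro continuous_on_subset[OF h(1)]) blast
    qed
    show "F (- v, x) = F (v, x)" for v x by (simp add: F_def \<rho>_def)
    show "hausdorff_measure 2 (range F) = 0"
      using hausdorff_measure_2_zero_subset[OF S \<open>range F \<subseteq> S\<close>] .
    show "F (v, x) = \<omega> 0" if "\<not> (\<bar>v\<bar> < 1 \<and> 0 < x \<and> x < 1)" for v x
      using that h(4)[of "max 0 (min 1 x)"] h(5)[of "min 1 \<bar>v\<bar>"] h(6)[of "min 1 \<bar>v\<bar>"] \<open>\<omega> 1 = \<omega> 0\<close>
      by (auto simp: F_def \<rho>_def min_def max_def split: if_splits)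
  qed
  have F0: "F (0, t) = \<omega> t" if "t \<in> {0..1}" for t
    using that h(3) by (simp add: F_def \<rho>_def)
  have "contractible_arc x y" if "linked x y" "0 \<le> x" "x < y" "y \<le> 1" for x y
  proof -
    have hp: "homotopic_paths S (\<lambda>t. F (0, x + t * (y - x))) (\<lambda>_. F (0, x))"
      using linked_imp_nullhomotopic[OF that] homotopic_paths_subset \<open>range F \<subseteq> S\<close> by blast
    have arc: "F (0, x + t * (y - x)) = \<omega> (x + t * (y - x))" if "t \<in> {0..1}" for t
    proof (rule F0)
      have "0 \<le> t * (y - x)" using that \<open>x < y\<close> by simp
      moreover have "t * (y - x) \<le> 1 * (y - x)" using that \<open>x < y\<close> by (intro mult_right_mono) auto
      ultimately show "x + t * (y - x) \<in> {0..1}" using \<open>0 \<le> x\<close> \<open>y \<le> 1\<close> by auto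
    qed
    have "homotopic_paths S (\<lambda>t. F (0, x + t * (y - x))) (\<lambda>t. \<omega> (x + t * (y - x)))"
      using homotopic_paths_imp_path[OF hp] homotopic_paths_imp_subset[OF hp] arc
      by (intro homotopic_paths_eq) auto
    from homotopic_paths_trans[OF homotopic_paths_sym[OF this] hp] show ?thesis
      using F0[of x] that by (simp add: contractible_arc_def)
  qed
  note arc = this
  from linked_interval[OF x] show ?thesis
  proof
    assume "\<exists>z\<in>{x1..x2}. \<exists>y\<in>{a..1}. linked z y"
    then obtain z y where "z \<in> {x1..x2}" "y \<in> {a..1}" "linked z y" by blast
    moreover from this have "contractible_arc z y" using arc[of z y] x by auto
    ultimately show ?thesis by blast
  next
    assume "\<exists>a' b'. 0 < a' \<and> a' < x1 \<and> x2 < b' \<and> b' < a \<and> linked a' b'"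
    then obtain a' b' where "0 < a'" "a' < x1" "x2 < b'" "b' < a" "linked a' b'" by blast
    moreover from this have "contractible_arc a' b'" using arc[of a' b'] x by auto
    ultimately show ?thesis by blast
  qed
qed

section \<open>Heights\<close>

text \<open>The null set may vary with the pair; transitivity and joins take unions. As
  \<open>homotopic_paths\<close> confines both paths to \<open>S\<close>, reflexivity is a
  condition: it holds for paths with null image.\<close>

definition thin_homotopic :: "(real \<Rightarrow> 'a::metric_space) \<Rightarrow> (real \<Rightarrow> 'a) \<Rightarrow> bool" where
  "thin_homotopic p q \<longleftrightarrow> (\<exists>S. hausdorff_measure 2 S = 0 \<and> homotopic_paths S p q)"

text \<open>\<open>u > v\<close> is allowed and runs the arc backwards, so one rule for joining also
  covers cancellation.\<close>

definition subarc :: "real \<Rightarrow> real \<Rightarrow> (real \<Rightarrow> 'a) \<Rightarrow> real \<Rightarrow> 'a" where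
  "subarc u v g = (\<lambda>t. g (u + t * (v - u)))"

lemma subarc_0_1 [simp]: "subarc 0 1 g = g"
  and subarc_1_0: "subarc 1 0 g = reversepath g"
  and subarc_refl: "subarc u u g = (\<lambda>_. g u)"
  and pathstart_subarc [simp]: "pathstart (subarc u v g) = g u"
  and pathfinish_subarc [simp]: "pathfinish (subarc u v g) = g v"
  by (simp_all add: subarc_def reversepath_def pathstart_def pathfinish_def)

lemma subarc_subarc: "subarc a b (subarc u v g) = subarc (u + a * (v - u)) (u + b * (v - u)) g"
  by (simp add: subarc_def fun_eq_iff algebra_simps)

lemma subarc_param:
  fixes u v :: real
  assumes "u \<in> {0..1}" "v \<in> {0..1}" "t \<in> {0..1}"
  shows "u + t * (v - u) \<in> {0..1}"
proof -
  have "u + t * (v - u) = (1 - t) * u + t * v" by (simp add: algebra_simps)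
  moreover have "(1 - t) * u + t * v \<le> 1" using assms by (intro convex_bound_le) auto
  ultimately show ?thesis using assms by simp
qed

lemma thin_homotopic_sym: "thin_homotopic p q \<Longrightarrow> thin_homotopic q p"
  unfolding thin_homotopic_def using homotopic_paths_sym by blast

lemma thin_homotopic_trans [trans]:
  assumes "thin_homotopic p q" "thin_homotopic q r"
  shows "thin_homotopic p r"
proof -
  obtain S T where S: "hausdorff_measure 2 S = 0" "homotopic_paths S p q"
    and T: "hausdorff_measure 2 T = 0" "homotopic_paths T q r"
    using assms unfolding thin_homotopic_def by blast
  have "homotopic_paths (S \<union> T) p q" "homotopic_paths (S \<union> T) q r"
    using S(2) T(2) homotopic_paths_subset by (metis Un_upper1, metis Un_upper2)
  then show ?thesis
    using hausdorff_measure_2_zero_Un[OF S(1) T(1)] homotopic_paths_trans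
    unfolding thin_homotopic_def by blast
qed

lemma thin_homotopic_endpoints:
  assumes "thin_homotopic p q"
  shows "pathstart p = pathstart q" "pathfinish p = pathfinish q"
  using assms homotopic_paths_imp_pathstart homotopic_paths_imp_pathfinish
  unfolding thin_homotopic_def by blast+

lemma thin_homotopic_refl1: "thin_homotopic p q \<Longrightarrow> thin_homotopic p p"
  and thin_homotopic_refl2: "thin_homotopic p q \<Longrightarrow> thin_homotopic q q"
  using thin_homotopic_sym thin_homotopic_trans by blast+

lemma thin_homotopic_refl_iff:
  "thin_homotopic p p \<longleftrightarrow> path p \<and> hausdorff_measure 2 (path_image p) = 0"
  unfolding thin_homotopic_def using hausdorff_measure_2_zero_subset by (metis homotopic_paths_refl order_refl)

lemma thin_homotopic_join:
  assumes "thin_homotopic p p'" "thin_homotopic q q'" "pathfinish p = pathstart q"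
  shows "thin_homotopic (p +++ q) (p' +++ q')"
proof -
  obtain S T where S: "hausdorff_measure 2 S = 0" "homotopic_paths S p p'"
    and T: "hausdorff_measure 2 T = 0" "homotopic_paths T q q'"
    using assms unfolding thin_homotopic_def by blast
  have "homotopic_paths (S \<union> T) p p'" "homotopic_paths (S \<union> T) q q'"
    using S(2) T(2) homotopic_paths_subset by (metis Un_upper1, metis Un_upper2)
  then show ?thesis
    using hausdorff_measure_2_zero_Un[OF S(1) T(1)] homotopic_paths_join assms(3)
    unfolding thin_homotopic_def by blast
qed

lemma thin_homotopic_eq:
  assumes "thin_homotopic p p" "\<And>t. t \<in> {0..1} \<Longrightarrow> p t = q t"
  shows "thin_homotopic p q"
  using assms homotopic_paths_eq[of p "path_image p" q]
  unfolding thin_homotopic_refl_iff thin_homotopic_def by blast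

text \<open>The library lemma on joining subpaths is stated for normed spaces only; here it is applied to
  the identity path of the unit interval and pushed forward.\<close>

lemma thin_homotopic_subarc_join:
  assumes "thin_homotopic g g" and uvw: "u \<in> {0..1}" "v \<in> {0..1}" "w \<in> {0..1}"
  shows "thin_homotopic (subarc u v g +++ subarc v w g) (subarc u w g)"
proof -
  have g: "path g" "hausdorff_measure 2 (path_image g) = 0"
    using assms(1) by (auto simp: thin_homotopic_refl_iff)
  have sub: "g \<circ> subpath a b (\<lambda>x. x) = subarc a b g" for a b
    by (simp add: subarc_def subpath_def fun_eq_iff algebra_simps)
  have "homotopic_paths {0..1} (subpath u v (\<lambda>x. x) +++ subpath v w (\<lambda>x. x)) (subpath u w (\<lambda>x::real. x))"
    by (rule homotopic_join_subpaths) (use uvw in \<open>auto simp: path_def path_image_def\<close>)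
  then have "homotopic_paths (path_image g)
      (g \<circ> (subpath u v (\<lambda>x. x) +++ subpath v w (\<lambda>x. x))) (g \<circ> subpath u w (\<lambda>x. x))"
    using g(1) by (rule_tac homotopic_paths_continuous_image) (auto simp: path_def path_image_def)
  then show ?thesis
    using g(2) unfolding thin_homotopic_def path_compose_join sub by blast
qed

lemma thin_homotopic_subarc:
  assumes "thin_homotopic g g" "u \<in> {0..1}" "v \<in> {0..1}"
  shows "thin_homotopic (subarc u v g) (subarc u v g)"
  using thin_homotopic_subarc_join[OF assms(1,2,2,3)] by (rule thin_homotopic_refl2)

lemma joinpaths_left_half: "x \<le> 1 \<Longrightarrow> (p +++ q) (x / 2) = p x"
  by (simp add: joinpaths_def)

lemma joinpaths_right_half:
  assumes "0 \<le> x" "pathfinish p = pathstart q"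
  shows "(p +++ q) ((1 + x) / 2) = q x"
proof (cases "x = 0")
  case True
  then show ?thesis using assms(2) by (simp add: joinpaths_def pathstart_def pathfinish_def)
next
  case False
  have "2 * ((1 + x) / 2) - 1 = x" by (simp add: field_simps)
  then show ?thesis using False assms(1) unfolding joinpaths_def by simp
qed

lemma thin_homotopic_subarc_join_left:
  assumes "thin_homotopic p p" "u \<in> {0..1}" "v \<in> {0..1}"
  shows "thin_homotopic (subarc (u / 2) (v / 2) (p +++ q)) (subarc u v p)"
proof (rule thin_homotopic_sym, rule thin_homotopic_eq)
  show "thin_homotopic (subarc u v p) (subarc u v p)" using assms by (rule thin_homotopic_subarc)
  show "subarc u v p t = subarc (u / 2) (v / 2) (p +++ q) t" if t: "t \<in> {0..1}" for t
  proof -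
    let ?x = "u + t * (v - u)"
    have "u / 2 + t * (v / 2 - u / 2) = ?x / 2" by (simp add: field_simps)
    then have "subarc (u / 2) (v / 2) (p +++ q) t = (p +++ q) (?x / 2)" by (simp only: subarc_def)
    moreover have "(p +++ q) (?x / 2) = p ?x"
      using subarc_param[OF assms(2,3) t] by (intro joinpaths_left_half) auto
    ultimately show ?thesis by (simp only: subarc_def)
  qed
qed

lemma thin_homotopic_subarc_join_right:
  assumes "thin_homotopic q q" "pathfinish p = pathstart q" "u \<in> {0..1}" "v \<in> {0..1}"
  shows "thin_homotopic (subarc ((1 + u) / 2) ((1 + v) / 2) (p +++ q)) (subarc u v q)"
proof (rule thin_homotopic_sym, rule thin_homotopic_eq)
  show "thin_homotopic (subarc u v q) (subarc u v q)" using assms by (intro thin_homotopic_subarc)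
  show "subarc u v q t = subarc ((1 + u) / 2) ((1 + v) / 2) (p +++ q) t" if t: "t \<in> {0..1}" for t
  proof -
    let ?x = "u + t * (v - u)"
    have x: "?x \<in> {0..1}" using subarc_param[OF assms(3,4) t] .
    have "(1 + u) / 2 + t * ((1 + v) / 2 - (1 + u) / 2) = (1 + ?x) / 2" by (simp add: field_simps)
    then have "subarc ((1 + u) / 2) ((1 + v) / 2) (p +++ q) t = (p +++ q) ((1 + ?x) / 2)"
      by (simp only: subarc_def)
    moreover have "(p +++ q) ((1 + ?x) / 2) = q ?x"
      using x assms(2) by (intro joinpaths_right_half) auto
    ultimately show ?thesis by (simp only: subarc_def)
  qed
qed

lemma thin_homotopic_reversepath: "thin_homotopic q q \<Longrightarrow> thin_homotopic (reversepath q) (reversepath q)"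
  unfolding subarc_1_0[symmetric] by (intro thin_homotopic_subarc) auto

lemma thin_homotopic_join_reversepath:
  assumes "thin_homotopic p q"
  shows "thin_homotopic (p +++ reversepath q) (subarc 0 0 q)"
proof -
  note tq = thin_homotopic_refl2[OF assms]
  have "thin_homotopic (p +++ reversepath q) (subarc 0 1 q +++ subarc 1 0 q)"
    unfolding subarc_1_0 using assms thin_homotopic_reversepath[OF tq] thin_homotopic_endpoints[OF assms]
    by (intro thin_homotopic_join) auto
  also have "thin_homotopic \<dots> (subarc 0 0 q)" using tq by (intro thin_homotopic_subarc_join) auto
  finally show ?thesis .
qed

text \<open>Inserting the contractible arc does not change the class. Costs thereby pass between the
  two ends of a paired arc.\<close>

lemma thin_homotopic_prefix:
  assumes "thin_homotopic g g" "x \<in> {0..1}" "y \<in> {0..1}"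
    and "thin_homotopic (subarc x y g) (subarc x x g)"
  shows "thin_homotopic (subarc 0 x g) (subarc 0 y g)"
proof -
  have "thin_homotopic (subarc 0 y g) (subarc 0 x g +++ subarc x y g)"
    using assms by (intro thin_homotopic_sym[OF thin_homotopic_subarc_join]) auto
  also have "thin_homotopic \<dots> (subarc 0 x g +++ subarc x x g)"
    using assms by (intro thin_homotopic_join thin_homotopic_subarc) auto
  also have "thin_homotopic \<dots> (subarc 0 x g)"
    using assms by (intro thin_homotopic_subarc_join) auto
  finally show ?thesis by (rule thin_homotopic_sym)
qed

section \<open>Length bounds up to thin homotopy\<close>

definition length_control :: "(real \<Rightarrow> real) \<Rightarrow> (real \<Rightarrow> 'a::metric_space) \<Rightarrow> bool" where
  "length_control \<kappa> \<beta> \<longleftrightarrow> continuous_on {0..1} \<kappa> \<and>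
     (\<forall>x y. 0 \<le> x \<longrightarrow> x \<le> y \<longrightarrow> y \<le> 1 \<longrightarrow> dist (\<beta> x) (\<beta> y) \<le> \<kappa> y - \<kappa> x)"

lemma length_control_dist:
  "length_control \<kappa> \<beta> \<Longrightarrow> 0 \<le> x \<Longrightarrow> x \<le> y \<Longrightarrow> y \<le> 1 \<Longrightarrow> dist (\<beta> x) (\<beta> y) \<le> \<kappa> y - \<kappa> x"
  unfolding length_control_def by blast

lemma length_control_mono:
  "length_control \<kappa> \<beta> \<Longrightarrow> 0 \<le> x \<Longrightarrow> x \<le> y \<Longrightarrow> y \<le> 1 \<Longrightarrow> \<kappa> x \<le> \<kappa> y"
  using length_control_dist[of \<kappa> \<beta> x y] zero_le_dist[of "\<beta> x" "\<beta> y"] by linarith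

text \<open>Length is bounded through a continuous \<open>\<kappa>\<close> instead of
  \<open>path_length\<close>: such bounds restrict and concatenate easily, and the intermediate
  value theorem picks a point of \<open>\<beta>\<close> with prescribed \<open>\<kappa>\<close>. The
  representative \<open>\<beta>\<close> need not be Lipschitz.\<close>

definition cost :: "(real \<Rightarrow> 'a::metric_space) \<Rightarrow> real \<Rightarrow> bool" where
  "cost P l \<longleftrightarrow> (\<exists>\<beta> \<kappa>. length_control \<kappa> \<beta> \<and> \<kappa> 1 - \<kappa> 0 \<le> l \<and> thin_homotopic P \<beta>)"

lemma cost_cong: "cost P l \<Longrightarrow> thin_homotopic P Q \<Longrightarrow> cost Q l"
  unfolding cost_def using thin_homotopic_sym thin_homotopic_trans by blast

lemma cost_dist:
  assumes "cost P l"
  shows "dist (pathstart P) (pathfinish P) \<le> l"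
proof -
  obtain \<beta> \<kappa> where b: "length_control \<kappa> \<beta>" "\<kappa> 1 - \<kappa> 0 \<le> l" "thin_homotopic P \<beta>"
    using assms unfolding cost_def by blast
  have "dist (\<beta> 0) (\<beta> 1) \<le> \<kappa> 1 - \<kappa> 0" by (rule length_control_dist[OF b(1)]) auto
  then show ?thesis
    using b(2) thin_homotopic_endpoints[OF b(3)] by (simp add: pathstart_def pathfinish_def)
qed

lemma cost_nonneg: "cost P l \<Longrightarrow> 0 \<le> l"
  using cost_dist zero_le_dist order_trans by metis

lemma cost_subarc:
  assumes c: "length_control \<kappa> \<beta>" and "thin_homotopic \<beta> \<beta>" "0 \<le> u" "u \<le> v" "v \<le> 1"
  shows "cost (subarc u v \<beta>) (\<kappa> v - \<kappa> u)"
  unfolding cost_def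
proof (intro exI conjI)
  have uv: "u \<in> {0..1}" "v \<in> {0..1}" using assms by auto
  show "thin_homotopic (subarc u v \<beta>) (subarc u v \<beta>)"
    using assms(2) uv by (rule thin_homotopic_subarc)
  show "subarc u v \<kappa> 1 - subarc u v \<kappa> 0 \<le> \<kappa> v - \<kappa> u" by (simp add: subarc_def)
  show "length_control (subarc u v \<kappa>) (subarc u v \<beta>)"
    unfolding length_control_def
  proof (intro conjI allI impI)
    have "continuous_on ((\<lambda>t. u + t * (v - u)) ` {0..1}) \<kappa>"
      using c subarc_param[OF uv] unfolding length_control_def
      by (elim conjE continuous_on_subset) blast
    moreover have "continuous_on {0..1} (\<lambda>t. u + t * (v - u))" by (intro continuous_intros)
    ultimately show "continuous_on {0..1} (subarc u v \<kappa>)"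
      using continuous_on_compose[of "{0..1}" "\<lambda>t. u + t * (v - u)" \<kappa>]
      unfolding subarc_def comp_def by blast
    fix x y :: real assume xy: "0 \<le> x" "x \<le> y" "y \<le> 1"
    have "u + x * (v - u) \<le> u + y * (v - u)" using xy assms by (simp add: mult_right_mono)
    then show "dist (subarc u v \<beta> x) (subarc u v \<beta> y) \<le> subarc u v \<kappa> y - subarc u v \<kappa> x"
      unfolding subarc_def using subarc_param[OF uv, of x] subarc_param[OF uv, of y] xy
      by (intro length_control_dist[OF c]) auto
  qed
qed

lemma cost_join:
  assumes "cost P l" "cost Q m" "pathfinish P = pathstart Q"
  shows "cost (P +++ Q) (l + m)"
proof -
  obtain \<beta> \<kappa> where b: "length_control \<kappa> \<beta>" "\<kappa> 1 - \<kappa> 0 \<le> l" "thin_homotopic P \<beta>"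
    using assms(1) unfolding cost_def by blast
  obtain \<beta>' \<kappa>' where b': "length_control \<kappa>' \<beta>'" "\<kappa>' 1 - \<kappa>' 0 \<le> m" "thin_homotopic Q \<beta>'"
    using assms(2) unfolding cost_def by blast
  define \<mu> where "\<mu> = \<kappa> +++ (\<lambda>x. \<kappa>' x - \<kappa>' 0 + \<kappa> 1)"
  have ends: "\<beta> 1 = \<beta>' 0"
    using thin_homotopic_endpoints[OF b(3)] thin_homotopic_endpoints[OF b'(3)] assms(3)
    by (simp add: pathstart_def pathfinish_def)
  have "length_control \<mu> (\<beta> +++ \<beta>')"
    unfolding length_control_def
  proof (intro conjI allI impI)
    have "path \<mu>" unfolding \<mu>_def
    proof (rule path_join_imp)
      show "path \<kappa>" using b(1) by (simp add: path_def length_control_def)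
      show "path (\<lambda>x. \<kappa>' x - \<kappa>' 0 + \<kappa> 1)"
        using b'(1) unfolding path_def length_control_def by (intro continuous_intros) auto
    qed (simp add: pathstart_def pathfinish_def)
    then show "continuous_on {0..1} \<mu>" by (simp add: path_def)
    fix x y :: real assume xy: "0 \<le> x" "x \<le> y" "y \<le> 1"
    consider "y \<le> 1/2" | "x \<le> 1/2" "1/2 < y" | "1/2 < x" by linarith
    then show "dist ((\<beta> +++ \<beta>') x) ((\<beta> +++ \<beta>') y) \<le> \<mu> y - \<mu> x"
    proof cases
      case 1
      then show ?thesis
        using length_control_dist[OF b(1), of "2*x" "2*y"] xy by (simp add: \<mu>_def joinpaths_def)
    next
      case 2
      have "dist (\<beta> (2*x)) (\<beta>' (2*y-1)) \<le> dist (\<beta> (2*x)) (\<beta> 1) + dist (\<beta>' 0) (\<beta>' (2*y-1))"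
        using dist_triangle ends by metis
      also have "\<dots> \<le> (\<kappa> 1 - \<kappa> (2*x)) + (\<kappa>' (2*y-1) - \<kappa>' 0)"
        using 2 xy by (intro add_mono length_control_dist[OF b(1)] length_control_dist[OF b'(1)]) auto
      finally show ?thesis using 2 by (simp add: \<mu>_def joinpaths_def)
    next
      case 3
      then show ?thesis
        using length_control_dist[OF b'(1), of "2*x-1" "2*y-1"] xy by (simp add: \<mu>_def joinpaths_def)
    qed
  qed
  moreover have "\<mu> 1 - \<mu> 0 \<le> l + m" using b(2) b'(2) by (simp add: \<mu>_def joinpaths_def)
  moreover have "thin_homotopic (P +++ Q) (\<beta> +++ \<beta>')" using b(3) b'(3) assms(3) by (rule thin_homotopic_join)
  ultimately show ?thesis unfolding cost_def by blast
qed

lemma cost_subarc_trans: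
  assumes "cost (subarc u v g) l" "cost (subarc v w g) m" "thin_homotopic g g"
    "u \<in> {0..1}" "v \<in> {0..1}" "w \<in> {0..1}"
  shows "cost (subarc u w g) (l + m)"
  using cost_join[OF assms(1,2)] thin_homotopic_subarc_join[OF assms(3-6)] by (auto intro: cost_cong)

text \<open>The source of finiteness: the infimum in \<open>height\<close> is over a nonempty set,
  and heights inherit the constant \<open>L\<close>.\<close>

lemma cost_lipschitz:
  assumes "L-lipschitz_on {0..1} g" "thin_homotopic g g" "s \<in> {0..1}" "t \<in> {0..1}"
  shows "cost (subarc s t g) (L * \<bar>t - s\<bar>)"
  unfolding cost_def
proof (intro exI conjI)
  show "thin_homotopic (subarc s t g) (subarc s t g)" using assms(2-4) by (rule thin_homotopic_subarc)
  show "length_control (\<lambda>x. L * \<bar>t - s\<bar> * x) (subarc s t g)"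
    unfolding length_control_def
  proof (intro conjI allI impI)
    fix x y :: real assume xy: "0 \<le> x" "x \<le> y" "y \<le> 1"
    have "dist (subarc s t g x) (subarc s t g y) \<le> L * dist (s + x * (t - s)) (s + y * (t - s))"
      unfolding subarc_def using xy
      by (intro lipschitz_onD[OF assms(1)] subarc_param assms) auto
    also have "dist (s + x * (t - s)) (s + y * (t - s)) = \<bar>(y - x) * (t - s)\<bar>"
      by (simp add: dist_real_def algebra_simps)
    also have "\<dots> = (y - x) * \<bar>t - s\<bar>" using xy by (simp add: abs_mult)
    finally show "dist (subarc s t g x) (subarc s t g y) \<le> L * \<bar>t - s\<bar> * y - L * \<bar>t - s\<bar> * x"
      by (simp add: algebra_simps)
  qed (intro continuous_intros)
qed simp

text \<open>Distance of the class of the initial arc from that of the constant path, as in the path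
  model of a universal cover.\<close>

definition height :: "(real \<Rightarrow> 'a::metric_space) \<Rightarrow> real \<Rightarrow> real" where
  "height g s = Inf {l. cost (subarc 0 s g) l}"

lemma height_le: "cost (subarc 0 s g) l \<Longrightarrow> height g s \<le> l"
  unfolding height_def using cost_nonneg by (intro cInf_lower bdd_belowI[of _ 0]) auto

context
  fixes g :: "real \<Rightarrow> 'a::metric_space" and L :: real
  assumes lip: "L-lipschitz_on {0..1} g" and thin: "thin_homotopic g g"
begin

lemma height_greatest:
  assumes "s \<in> {0..1}" "\<And>l. cost (subarc 0 s g) l \<Longrightarrow> c \<le> l"
  shows "c \<le> height g s"
  unfolding height_def using cost_lipschitz[OF lip thin, of 0 s] assms
  by (intro cInf_greatest) auto

lemma height_approx:
  assumes "s \<in> {0..1}" "e > 0"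
  obtains l where "cost (subarc 0 s g) l" "l < height g s + e"
  using height_greatest[OF assms(1), of "height g s + e"] assms(2) by force

lemma height_nonneg: "s \<in> {0..1} \<Longrightarrow> 0 \<le> height g s"
  using height_greatest cost_nonneg by blast

lemma height_0: "height g 0 = 0"
  using height_le[OF cost_lipschitz[OF lip thin, of 0 0]] height_nonneg[of 0] by auto

lemma dist_le_height: "s \<in> {0..1} \<Longrightarrow> dist (g 0) (g s) \<le> height g s"
  using cost_dist by (intro height_greatest) fastforce+

lemma height_lipschitz:
  assumes "s \<in> {0..1}" "t \<in> {0..1}"
  shows "\<bar>height g s - height g t\<bar> \<le> L * \<bar>s - t\<bar>"
proof -
  have "height g t - L * \<bar>t - s\<bar> \<le> height g s" if "s \<in> {0..1}" "t \<in> {0..1}" for s t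
  proof (rule height_greatest[OF that(1)])
    fix l assume "cost (subarc 0 s g) l"
    then have "cost (subarc 0 t g) (l + L * \<bar>t - s\<bar>)"
      using cost_lipschitz[OF lip thin that] that thin by (intro cost_subarc_trans[of 0 s]) auto
    then show "height g t - L * \<bar>t - s\<bar> \<le> l" using height_le by fastforce
  qed
  from this[OF assms] this[OF assms(2,1)] show ?thesis by (simp add: abs_minus_commute abs_le_iff)
qed

text \<open>The heights make the path tree-like. Almost shortest representatives of the homotopy classes of
  the initial parts up to \<open>s\<close> and up to \<open>t\<close>, joined by the part of the path in between, form a
  contractible loop; slightly below height \<open>v\<close> a point of the first representative must be
  paired with a point of the second.\<close>

lemma height_tree_inequality:
  assumes st: "0 \<le> s" "s \<le> t" "t \<le> 1" and v: "\<And>u. u \<in> {s..t} \<Longrightarrow> v \<le> height g u"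
  shows "dist (g s) (g t) \<le> height g s + height g t - 2 * v"
proof (rule field_le_epsilon)
  fix e0 :: real assume "e0 > 0"
  \<comment> \<open>The final estimate loses \<open>3 * e\<close> along \<open>\<beta>\<close> and
    \<open>4 * e\<close> along \<open>\<beta>'\<close>.\<close>
  define e where "e = e0 / 8"
  have "e > 0" using \<open>e0 > 0\<close> by (simp add: e_def)
  have st01: "s \<in> {0..1}" "t \<in> {0..1}" using st by auto
  show "dist (g s) (g t) \<le> height g s + height g t - 2 * v + e0"
  \<comment> \<open>For small \<open>v\<close> the detour through the base point is short enough.
    Otherwise \<open>v - 2 * e\<close> is positive, which gives \<open>x1 > 0\<close>.\<close>
  proof (cases "v \<le> 3 * e")
    case True
    have "dist (g s) (g t) \<le> dist (g 0) (g s) + dist (g 0) (g t)" by (rule dist_triangle3)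
    also have "\<dots> \<le> height g s + height g t" using st01 by (intro add_mono dist_le_height)
    finally show ?thesis using True \<open>e > 0\<close> by (simp add: e_def)
  next
    case False
    obtain \<beta> \<kappa>0 where b0: "length_control \<kappa>0 \<beta>" "\<kappa>0 1 - \<kappa>0 0 < height g s + e"
        and hs: "thin_homotopic (subarc 0 s g) \<beta>"
      using height_approx[OF st01(1) \<open>e > 0\<close>] unfolding cost_def by (metis le_less_trans)
    obtain \<beta>' \<kappa>' where b': "length_control \<kappa>' \<beta>'" "\<kappa>' 1 - \<kappa>' 0 < height g t + e"
        and ht: "thin_homotopic (subarc 0 t g) \<beta>'"
      using height_approx[OF st01(2) \<open>e > 0\<close>] unfolding cost_def by (metis le_less_trans)
    define \<kappa> where "\<kappa> x = \<kappa>0 x - \<kappa>0 0" for x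
    have b: "length_control \<kappa> \<beta>" "\<kappa> 0 = 0" "\<kappa> 1 < height g s + e"
      using b0 unfolding length_control_def \<kappa>_def by (auto intro!: continuous_intros)
    note tb = thin_homotopic_refl2[OF hs] and tb' = thin_homotopic_refl2[OF ht]
    have ends: "\<beta> 0 = g 0" "\<beta> 1 = g s" "\<beta>' 0 = g 0" "\<beta>' 1 = g t"
      using thin_homotopic_endpoints[OF hs] thin_homotopic_endpoints[OF ht]
      by (simp_all add: pathstart_def pathfinish_def subarc_def)
    \<comment> \<open>Almost optimality of \<open>\<beta>\<close>: a cheap replacement of its part
      up to \<open>z\<close> would give a cheap representative of the arc up to
      \<open>s\<close>.\<close>
    have s_le: "height g s \<le> m + \<kappa> 1 - \<kappa> z" if "cost (subarc 0 z \<beta>) m" "z \<in> {0..1}" for m z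
    proof -
      have "cost (subarc z 1 \<beta>) (\<kappa> 1 - \<kappa> z)" using that by (intro cost_subarc[OF b(1) tb]) auto
      then have "cost (subarc 0 1 \<beta>) (m + (\<kappa> 1 - \<kappa> z))"
        using that tb by (intro cost_subarc_trans[of 0 z]) auto
      then have "cost (subarc 0 s g) (m + (\<kappa> 1 - \<kappa> z))"
        using cost_cong[OF _ thin_homotopic_sym[OF hs]] by simp
      then show ?thesis using height_le by fastforce
    qed
    have "v \<le> height g s" using v st by auto
    also have "\<dots> \<le> \<kappa> 1" using s_le[of 0 0] b(2) cost_subarc[OF b(1) tb, of 0 0] by auto
    finally have "v \<le> \<kappa> 1" .
    have cont: "continuous_on {0..1} \<kappa>" using b(1) by (simp add: length_control_def)
    \<comment> \<open>The band from \<open>v - 2 * e\<close> to \<open>v - e\<close> lies below all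
      heights on \<open>[s,t]\<close>, so its points cannot be paired with that part of
      \<open>g\<close>. Its width \<open>e\<close> exceeds \<open>\<kappa> 1 - height g s\<close>,
      so no contractible arc of \<open>\<beta>\<close> can skip it.\<close>
    obtain x1 where x1: "0 \<le> x1" "x1 \<le> 1" "\<kappa> x1 = v - 2 * e"
      using IVT'[of \<kappa> 0 "v - 2 * e" 1] cont b(2) False \<open>e > 0\<close> \<open>v \<le> \<kappa> 1\<close> by auto
    obtain x2 where x2: "x1 \<le> x2" "x2 \<le> 1" "\<kappa> x2 = v - e"
      using IVT'[of \<kappa> x1 "v - e" 1] x1 \<open>e > 0\<close> \<open>v \<le> \<kappa> 1\<close> continuous_on_subset[OF cont, of "{x1..1}"] by auto
    have "x1 > 0" using x1 b(2) False \<open>e > 0\<close> by (cases "x1 = 0") auto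
    have "x2 < 1" using x2 \<open>v \<le> \<kappa> 1\<close> \<open>e > 0\<close> by (cases "x2 = 1") auto
    define \<pi> where "\<pi> = \<beta> +++ subarc s t g"
    \<comment> \<open>The loop follows \<open>\<beta>\<close> on \<open>[0, 1/4]\<close>,
      \<open>g\<close> on \<open>[1/4, 1/2]\<close> and \<open>\<beta>'\<close> backwards on
      \<open>[1/2, 1]\<close>; hence the factors 4 and 2 below.\<close>
    define \<omega> where "\<omega> = \<pi> +++ reversepath \<beta>'"
    have "thin_homotopic \<pi> (subarc 0 s g +++ subarc s t g)"
      unfolding \<pi>_def using hs thin st01 ends
      by (intro thin_homotopic_join thin_homotopic_subarc) (auto simp: pathfinish_def intro: thin_homotopic_sym)
    also have "thin_homotopic \<dots> (subarc 0 t g)"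
      using thin st01 by (intro thin_homotopic_subarc_join) auto
    also note ht
    finally have \<pi>: "thin_homotopic \<pi> \<beta>'" .
    note t\<pi> = thin_homotopic_refl1[OF \<pi>]
    note rev = thin_homotopic_reversepath[OF tb']
    have \<pi>1: "pathfinish \<pi> = pathstart (reversepath \<beta>')"
      using thin_homotopic_endpoints[OF \<pi>] by simp
    have \<omega>: "thin_homotopic \<omega> (subarc 0 0 \<beta>')"
      unfolding \<omega>_def using \<pi> by (rule thin_homotopic_join_reversepath)
    note t\<omega> = thin_homotopic_refl1[OF \<omega>]
    have "\<omega> 0 = \<beta>' 0" using thin_homotopic_endpoints[OF \<omega>] by (simp add: pathstart_def subarc_def)
    then obtain S where S: "hausdorff_measure 2 S = 0" "homotopic_paths S \<omega> (\<lambda>_. \<omega> 0)"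
      using \<omega> unfolding thin_homotopic_def subarc_refl by metis
    have initial: "thin_homotopic (subarc 0 z \<omega>) (subarc 0 (4 * z) \<beta>)" if "0 \<le> z" "z \<le> 1/4" for z
    proof -
      have "thin_homotopic (subarc (0/2) ((2*z)/2) \<omega>) (subarc 0 (2*z) \<pi>)"
        unfolding \<omega>_def using that t\<pi> by (intro thin_homotopic_subarc_join_left) auto
      moreover have "thin_homotopic (subarc (0/2) ((4*z)/2) \<pi>) (subarc 0 (4*z) \<beta>)"
        unfolding \<pi>_def using that tb by (intro thin_homotopic_subarc_join_left) auto
      ultimately show ?thesis using thin_homotopic_trans by fastforce
    qed
    have initial_cost: "cost (subarc 0 z \<omega>) (\<kappa> (4 * z))" if "0 \<le> z" "z \<le> 1/4" for z
      using cost_cong[OF _ thin_homotopic_sym[OF initial[OF that]]]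
        cost_subarc[OF b(1) tb, of 0 "4 * z"] that b(2) by simp
    have prefix: "thin_homotopic (subarc 0 x \<omega>) (subarc 0 y \<omega>)" "\<omega> x = \<omega> y"
      if arc: "homotopic_paths S (\<lambda>t. \<omega> (x + t * (y - x))) (\<lambda>_. \<omega> x)"
        and "x \<in> {0..1}" "y \<in> {0..1}" for x y
    proof -
      have th: "thin_homotopic (subarc x y \<omega>) (subarc x x \<omega>)"
        using arc S(1) unfolding thin_homotopic_def subarc_def by auto
      from thin_homotopic_prefix[OF t\<omega> that(2,3) th]
      show "thin_homotopic (subarc 0 x \<omega>) (subarc 0 y \<omega>)" .
      show "\<omega> x = \<omega> y" using thin_homotopic_endpoints(2)[OF th] by simp
    qed
    have "(\<exists>z\<in>{x1/4..x2/4}. \<exists>y\<in>{1/4..1}. homotopic_paths S (\<lambda>t. \<omega> (z + t * (y - z))) (\<lambda>_. \<omega> z)) \<or>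
      (\<exists>a b. 0 < a \<and> a < x1/4 \<and> x2/4 < b \<and> b < 1/4 \<and>
         homotopic_paths S (\<lambda>t. \<omega> (a + t * (b - a))) (\<lambda>_. \<omega> a))"
      by (rule nullhomotopic_loop_pairing[OF S(2,1)]) (use \<open>x1 > 0\<close> \<open>x2 < 1\<close> x2(1) in auto)
    then consider
      (paired) z y where "z \<in> {x1/4..x2/4}" "y \<in> {1/4..1}"
        "homotopic_paths S (\<lambda>t. \<omega> (z + t * (y - z))) (\<lambda>_. \<omega> z)"
      | (covered) a b where "0 < a" "a < x1/4" "x2/4 < b" "b < 1/4"
        "homotopic_paths S (\<lambda>t. \<omega> (a + t * (b - a))) (\<lambda>_. \<omega> a)"
      by blast
    then show ?thesis
    proof cases
      case covered
      have "cost (subarc 0 b \<omega>) (\<kappa> (4 * a))"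
        using cost_cong[OF initial_cost prefix(1)[OF covered(5)]] covered x1 x2 by auto
      then have "cost (subarc 0 (4 * b) \<beta>) (\<kappa> (4 * a))"
        using cost_cong[OF _ initial] covered x1 x2 by auto
      then have "height g s \<le> \<kappa> (4 * a) + \<kappa> 1 - \<kappa> (4 * b)"
        using s_le covered x1 x2 by auto
      moreover have "\<kappa> (4 * a) \<le> \<kappa> x1" "\<kappa> x2 \<le> \<kappa> (4 * b)"
        using covered x1(1,2) x2(1,2) by (intro length_control_mono[OF b(1)]; simp)+
      ultimately show ?thesis using x1 x2 b(3) by simp
    next
      case paired
      define z' where "z' = 4 * z"
      have z: "z \<in> {0..1}" "y \<in> {0..1}" "0 \<le> z" "z \<le> 1/4" "x1 \<le> z'" "z' \<le> x2"
        using paired x1 x2 by (auto simp: z'_def)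
      note th = prefix[OF paired(3) z(1,2)]
      have cost_y: "cost (subarc 0 y \<omega>) (\<kappa> z')"
        using cost_cong[OF initial_cost th(1)] z by (simp add: z'_def)
      have \<kappa>z': "v - 2 * e \<le> \<kappa> z'" "\<kappa> z' \<le> v - e"
        using length_control_mono[OF b(1), of x1 z'] length_control_mono[OF b(1), of z' x2] x1 x2 z by auto
      \<comment> \<open>A partner \<open>w\<close> in \<open>[s,t]\<close> would have height at most
        \<open>\<kappa> z'\<close>, which is less than \<open>v\<close>.\<close>
      have "1/2 < y"
      proof (rule ccontr)
        assume "\<not> 1/2 < y"
        define c where "c = 4 * y - 1"
        have c: "c \<in> {0..1}" "0 \<in> {0..1::real}" using \<open>\<not> 1/2 < y\<close> paired(2) by (auto simp: c_def)
        define w where "w = s + c * (t - s)"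
        have "0 \<le> c * (t - s)" "c * (t - s) \<le> t - s"
          using c st by (auto intro: mult_left_le_one_le)
        then have w: "w \<in> {s..t}" by (auto simp: w_def)
        have "thin_homotopic (subarc (0/2) ((2*y)/2) \<omega>) (subarc 0 (2*y) \<pi>)"
          unfolding \<omega>_def using paired(2) \<open>\<not> 1/2 < y\<close> t\<pi> by (intro thin_homotopic_subarc_join_left) auto
        then have "thin_homotopic (subarc 0 y \<omega>) (subarc 0 (2*y) \<pi>)" by simp
        also have "thin_homotopic \<dots> (subarc 0 (1/2) \<pi> +++ subarc (1/2) (2*y) \<pi>)"
          using paired(2) \<open>\<not> 1/2 < y\<close> t\<pi> by (intro thin_homotopic_sym[OF thin_homotopic_subarc_join]) auto
        also have "thin_homotopic \<dots> (\<beta> +++ subarc s w g)"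
        proof (rule thin_homotopic_join)
          show "thin_homotopic (subarc 0 (1/2) \<pi>) \<beta>"
            using thin_homotopic_subarc_join_left[OF tb, of 0 1 "subarc s t g"] by (simp add: \<pi>_def)
          have "thin_homotopic (subarc ((1+0)/2) ((1+c)/2) \<pi>) (subarc 0 c (subarc s t g))"
            unfolding \<pi>_def using thin st01 c ends
            by (intro thin_homotopic_subarc_join_right thin_homotopic_subarc) (auto simp: pathfinish_def)
          moreover have "(1 + c) / 2 = 2 * y" by (simp add: c_def)
          ultimately show "thin_homotopic (subarc (1/2) (2*y) \<pi>) (subarc s w g)"
            by (simp add: subarc_subarc w_def)
        qed simp
        also have "thin_homotopic \<dots> (subarc 0 s g +++ subarc s w g)"
          using hs thin st01 w ends st
          by (intro thin_homotopic_join thin_homotopic_subarc) (auto simp: pathfinish_def intro: thin_homotopic_sym)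
        also have "thin_homotopic \<dots> (subarc 0 w g)"
          using thin st01 w by (intro thin_homotopic_subarc_join) auto
        finally have "cost (subarc 0 w g) (\<kappa> z')" using cost_y cost_cong by blast
        then have "v \<le> \<kappa> z'" using v[OF w] height_le by fastforce
        then show False using \<kappa>z'(2) \<open>e > 0\<close> by simp
      qed
      define y' where "y' = 2 - 2 * y"
      have y': "y' \<in> {0..1}" using \<open>1/2 < y\<close> paired(2) by (auto simp: y'_def)
      have y_eq: "y = (1 + (1 - y')) / 2" by (simp add: y'_def)
      have "thin_homotopic (subarc 0 y \<omega>) (subarc 0 (1/2) \<omega> +++ subarc (1/2) y \<omega>)"
        using t\<omega> z by (intro thin_homotopic_sym[OF thin_homotopic_subarc_join]) auto
      also have "thin_homotopic \<dots> (subarc 0 1 \<beta>' +++ subarc 1 y' \<beta>')"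
      proof (rule thin_homotopic_join)
        show "thin_homotopic (subarc 0 (1/2) \<omega>) (subarc 0 1 \<beta>')"
          using thin_homotopic_trans[OF thin_homotopic_subarc_join_left[OF t\<pi>, of 0 1 "reversepath \<beta>'"]] \<pi>
          by (simp add: \<omega>_def)
        have "thin_homotopic (subarc ((1+0)/2) ((1+(1-y'))/2) \<omega>) (subarc 0 (1-y') (reversepath \<beta>'))"
          unfolding \<omega>_def using rev \<pi>1 y' by (intro thin_homotopic_subarc_join_right) auto
        then show "thin_homotopic (subarc (1/2) y \<omega>) (subarc 1 y' \<beta>')"
          unfolding y_eq[symmetric] subarc_1_0[symmetric] subarc_subarc by simp
      qed simp
      also have "thin_homotopic \<dots> (subarc 0 y' \<beta>')"
        using tb' y' by (intro thin_homotopic_subarc_join) auto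
      finally have y\<beta>: "thin_homotopic (subarc 0 y \<omega>) (subarc 0 y' \<beta>')" .
      have z\<beta>: "thin_homotopic (subarc 0 z \<omega>) (subarc 0 z' \<beta>)"
        using initial[of z] z by (simp add: z'_def)
      \<comment> \<open>The part of \<open>\<beta>'\<close> up to \<open>y'\<close> can replace that
        of \<open>\<beta>\<close> up to \<open>z'\<close>, so it is nearly as long; the rest of
        \<open>\<beta>'\<close> then has length at most about \<open>height g t - v\<close>.\<close>
      have "thin_homotopic (subarc 0 y' \<beta>') (subarc 0 z' \<beta>)"
        using y\<beta> th(1) z\<beta> thin_homotopic_sym thin_homotopic_trans by blast
      moreover have "cost (subarc 0 y' \<beta>') (\<kappa>' y' - \<kappa>' 0)"
        using y' by (intro cost_subarc[OF b'(1) tb']) auto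
      ultimately have "cost (subarc 0 z' \<beta>) (\<kappa>' y' - \<kappa>' 0)" by (rule cost_cong[rotated])
      then have "height g s \<le> \<kappa>' y' - \<kappa>' 0 + \<kappa> 1 - \<kappa> z'"
        by (rule s_le) (use x1 x2 z in auto)
      moreover have "\<beta> z' = \<beta>' y'"
        using thin_homotopic_endpoints(2)[OF y\<beta>] thin_homotopic_endpoints(2)[OF z\<beta>] th(2) by simp
      then have "dist (g s) (g t) \<le> dist (\<beta> z') (\<beta> 1) + dist (\<beta>' y') (\<beta>' 1)"
        using dist_triangle3[of "g s" "g t" "\<beta> z'"] ends by simp
      then have "dist (g s) (g t) \<le> (\<kappa> 1 - \<kappa> z') + (\<kappa>' 1 - \<kappa>' y')"
        using length_control_dist[OF b(1), of z' 1] length_control_dist[OF b'(1), of y' 1] x1 x2 z y' by auto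
      ultimately show ?thesis
        using \<kappa>z'(1) b(3) b'(2) \<open>e0 > 0\<close> unfolding e_def by linarith
    qed
  qed
qed

end

section \<open>Sliding down the tree\<close>

text \<open>In the tree coded by \<open>h\<close>, the ancestor of \<open>s\<close> at height
  \<open>v\<close>, provided \<open>v\<close> lies between \<open>future_min h s\<close> and
  \<open>h s\<close>.\<close>

definition first_below :: "(real \<Rightarrow> real) \<Rightarrow> real \<Rightarrow> real \<Rightarrow> real" where
  "first_below h s v = Inf {t \<in> {s..1}. h t \<le> v}"

definition future_min :: "(real \<Rightarrow> real) \<Rightarrow> real \<Rightarrow> real" where
  "future_min h s = Inf (h ` {s..1})"

text \<open>The metric content of the heights, isolated because it is applied to two paths:
  \<open>\<gamma>\<close> and the loop returning along \<open>\<alpha>\<close>.\<close>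

locale tree_path =
  fixes g :: "real \<Rightarrow> 'a::metric_space" and h :: "real \<Rightarrow> real" and L :: real
  assumes h_lip: "\<And>s t. s \<in> {0..1} \<Longrightarrow> t \<in> {0..1} \<Longrightarrow> \<bar>h s - h t\<bar> \<le> L * \<bar>s - t\<bar>"
    and h_0: "h 0 = 0" and h_nonneg: "\<And>s. s \<in> {0..1} \<Longrightarrow> 0 \<le> h s"
    and tree: "\<And>s t v. 0 \<le> s \<Longrightarrow> s \<le> t \<Longrightarrow> t \<le> 1 \<Longrightarrow> (\<And>u. u \<in> {s..t} \<Longrightarrow> v \<le> h u) \<Longrightarrow>
      dist (g s) (g t) \<le> h s + h t - 2 * v"
begin

abbreviation "\<tau> \<equiv> first_below h"
abbreviation "m \<equiv> future_min h"

lemma L_nonneg: "0 \<le> L"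
  using h_lip[of 0 1] by auto

lemma cont_h: "continuous_on {0..1} h"
proof (rule lipschitz_on_continuous_on)
  show "L-lipschitz_on {0..1} h"
    using h_lip L_nonneg by (intro lipschitz_onI) (auto simp: dist_real_def)
qed

lemma future_min_attained:
  assumes "s \<in> {0..1}"
  obtains t where "t \<in> {s..1}" "h t = m s"
proof -
  have "continuous_on {s..1} h" using cont_h assms by (auto intro: continuous_on_subset)
  then obtain t where t: "t \<in> {s..1}" "\<And>u. u \<in> {s..1} \<Longrightarrow> h t \<le> h u"
    using continuous_attains_inf[of "{s..1}" h] assms by auto
  then have "m s = h t" unfolding future_min_def by (intro cInf_eq_minimum) auto
  then show ?thesis using that t(1) by metis
qed

lemma future_min_le:
  assumes "s \<in> {0..1}" "t \<in> {s..1}"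
  shows "m s \<le> h t"
  unfolding future_min_def using assms h_nonneg by (intro cInf_lower bdd_belowI[of _ 0]) auto

lemma future_min_mono:
  assumes "0 \<le> s" "s \<le> s'" "s' \<le> 1"
  shows "m s \<le> m s'"
proof -
  obtain t where "t \<in> {s'..1}" "h t = m s'" using future_min_attained[of s'] assms by auto
  then show ?thesis using future_min_le[of s t] assms by auto
qed

lemma future_min_lipschitz:
  assumes "0 \<le> s" "s \<le> s'" "s' \<le> 1"
  shows "m s' \<le> m s + L * (s' - s)"
proof -
  obtain t where t: "t \<in> {s..1}" "h t = m s" using future_min_attained[of s] assms by auto
  show ?thesis
  proof (cases "s' \<le> t")
    case True
    moreover have "0 \<le> L * (s' - s)" using L_nonneg assms by simp
    ultimately show ?thesis using future_min_le[of s' t] t assms by auto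
  next
    case False
    have "m s' \<le> h s'" using assms by (intro future_min_le) auto
    also have "\<dots> \<le> h t + L * \<bar>s' - t\<bar>" using h_lip[of s' t] t assms by auto
    also have "L * \<bar>s' - t\<bar> \<le> L * (s' - s)" using t False L_nonneg by (intro mult_left_mono) auto
    finally show ?thesis using t(2) by simp
  qed
qed

lemma future_min_0: "m 0 = 0" and future_min_1: "m 1 = h 1"
proof -
  obtain t where "t \<in> {0..1}" "h t = m 0" using future_min_attained[of 0] by auto
  then show "m 0 = 0" using h_nonneg[of t] future_min_le[of 0 0] h_0 by auto
  obtain t where "t \<in> {1..1}" "h t = m 1" using future_min_attained[of 1] by auto
  then show "m 1 = h 1" by auto
qed

lemma first_below:
  assumes "s \<in> {0..1}" "m s \<le> v" "v \<le> h s"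
  shows "\<tau> s v \<in> {s..1}" "h (\<tau> s v) = v" "\<And>u. u \<in> {s..\<tau> s v} \<Longrightarrow> v \<le> h u"
    and "\<And>t. t \<in> {s..1} \<Longrightarrow> h t \<le> v \<Longrightarrow> \<tau> s v \<le> t"
proof -
  let ?A = "{t \<in> {s..1}. h t \<le> v}"
  obtain t where "t \<in> {s..1}" "h t = m s" using future_min_attained[OF assms(1)] .
  then have ne: "?A \<noteq> {}" using assms(2) by auto
  have bdd: "bdd_below ?A" by (intro bdd_belowI[of _ s]) auto
  have cont: "continuous_on {s..1} h" using cont_h assms by (auto intro: continuous_on_subset)
  have "closed ?A"
    using continuous_closed_preimage[OF cont, of "{..v}"] by (simp add: vimage_def Int_def)
  then have A: "\<tau> s v \<in> ?A" unfolding first_below_def by (rule closed_contains_Inf[OF ne bdd])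
  show least: "\<tau> s v \<le> t" if "t \<in> {s..1}" "h t \<le> v" for t
    unfolding first_below_def using that by (intro cInf_lower bdd) auto
  show "\<tau> s v \<in> {s..1}" using A by simp
  show eq: "h (\<tau> s v) = v"
  proof (rule ccontr)
    assume "h (\<tau> s v) \<noteq> v"
    then have "h (\<tau> s v) < v" using A by simp
    moreover have "continuous_on {s..\<tau> s v} h" using cont A by (auto intro: continuous_on_subset)
    ultimately obtain u where u: "s \<le> u" "u \<le> \<tau> s v" "h u = v"
      using IVT2'[of h "\<tau> s v" v s] A assms(3) by auto
    then have "\<tau> s v \<le> u" using A by (intro least) auto
    then show False using u \<open>h (\<tau> s v) \<noteq> v\<close> by simp
  qed
  show "v \<le> h u" if "u \<in> {s..\<tau> s v}" for u
    using least[of u] that A eq by (cases "h u \<le> v") auto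
qed

text \<open>If the search from \<open>s\<close> ends no earlier than \<open>s'\<close>, one of the
  two points is an ancestor of the other, and only the difference of heights counts.\<close>

lemma dist_first_below:
  assumes s: "0 \<le> s" "s \<le> s'" "s' \<le> 1"
    and v: "m s \<le> v" "v \<le> h s" and v': "m s' \<le> v'" "v' \<le> h s'"
  shows "s' \<le> \<tau> s v \<Longrightarrow> dist (g (\<tau> s v)) (g (\<tau> s' v')) \<le> \<bar>v - v'\<bar>"
    and "dist (g (\<tau> s v)) (g (\<tau> s' v')) \<le> \<bar>v - v'\<bar> + 2 * L * (s' - s)"
proof -
  have ss: "s \<in> {0..1}" "s' \<in> {0..1}" using s by auto
  note t1 = first_below[OF ss(1) v] and t2 = first_below[OF ss(2) v']
  show late: "dist (g (\<tau> s v)) (g (\<tau> s' v')) \<le> \<bar>v - v'\<bar>" if "s' \<le> \<tau> s v"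
  proof (cases "v \<le> v'")
    case True
    then have "\<tau> s' v' \<le> \<tau> s v" using t1 t2(4) that by auto
    then have "dist (g (\<tau> s' v')) (g (\<tau> s v)) \<le> h (\<tau> s' v') + h (\<tau> s v) - 2 * v"
      using t1 t2 s by (intro tree) auto
    then show ?thesis using True t1(2) t2(2) by (simp add: dist_commute)
  next
    case False
    then have "\<tau> s v \<le> \<tau> s' v'" using t2 t1(4) s by auto
    then have "dist (g (\<tau> s v)) (g (\<tau> s' v')) \<le> h (\<tau> s v) + h (\<tau> s' v') - 2 * v'"
      using t1 t2 s that by (intro tree) auto
    then show ?thesis using False t1(2) t2(2) by simp
  qed
  show "dist (g (\<tau> s v)) (g (\<tau> s' v')) \<le> \<bar>v - v'\<bar> + 2 * L * (s' - s)"
  proof (cases "s' \<le> \<tau> s v")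
    case True
    moreover have "0 \<le> 2 * L * (s' - s)" using L_nonneg s by simp
    ultimately show ?thesis using late by linarith
  next
    case False
    \<comment> \<open>A lower bound for \<open>h\<close> between the two points: up to
      \<open>s'\<close> by the Lipschitz bound and \<open>v' \<le> h s'\<close>, afterwards because
      the search from \<open>s'\<close> is still running.\<close>
    let ?w = "v' - L * (s' - s)"
    have "?w \<le> h u" if u: "u \<in> {\<tau> s v..\<tau> s' v'}" for u
    proof (cases "u \<le> s'")
      case True
      have "h s' - h u \<le> L * \<bar>s' - u\<bar>" using h_lip[of s' u] t1(1) u True s by auto
      also have "\<dots> \<le> L * (s' - s)" using t1(1) u True L_nonneg by (intro mult_left_mono) auto
      finally show ?thesis using v' by simp
    next
      case False
      then have "v' \<le> h u" using u t2(3) by auto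
      moreover have "0 \<le> L * (s' - s)" using L_nonneg s by simp
      ultimately show ?thesis by linarith
    qed
    then have "dist (g (\<tau> s v)) (g (\<tau> s' v')) \<le> h (\<tau> s v) + h (\<tau> s' v') - 2 * ?w"
      using False t1(1) t2(1) s by (intro tree) auto
    also have "\<dots> = v - v' + 2 * L * (s' - s)" using t1(2) t2(2) by (simp add: algebra_simps)
    finally show ?thesis by linarith
  qed
qed

text \<open>The meet of \<open>s\<close> and the endpoint 1 in the tree. As \<open>s\<close> grows,
  the meets climb the branch to the endpoint, pausing during excursions.\<close>

definition geodesic :: "real \<Rightarrow> 'a" where
  "geodesic s = g (\<tau> s (m s))"

lemma future_min_le_self: "s \<in> {0..1} \<Longrightarrow> m s \<le> h s"
  by (intro future_min_le) auto

text \<open>If the point chosen for \<open>s\<close> comes after \<open>s'\<close>, then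
  \<open>m\<close> is constant in between and the two points coincide; otherwise \<open>m s\<close>
  is a lower bound for the tree inequality. In total \<open>m\<close> rises from 0 to
  \<open>h 1\<close>.\<close>

lemma dist_geodesic:
  assumes "0 \<le> s" "s \<le> s'" "s' \<le> 1"
  shows "dist (geodesic s) (geodesic s') \<le> m s' - m s"
proof -
  have ss: "s \<in> {0..1}" "s' \<in> {0..1}" using assms by auto
  note t1 = first_below[OF ss(1) order_refl future_min_le_self[OF ss(1)]]
  note t2 = first_below[OF ss(2) order_refl future_min_le_self[OF ss(2)]]
  show ?thesis
  proof (cases "s' \<le> \<tau> s (m s)")
    case True
    then have "m s' \<le> m s" using future_min_le[OF ss(2), of "\<tau> s (m s)"] t1 by auto
    then have "m s' = m s" using future_min_mono[OF assms] by simp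
    then show ?thesis
      using dist_first_below(1)[OF assms _ _ _ _ True, of "m s'"]
        future_min_le_self[OF ss(1)] future_min_le_self[OF ss(2)]
      by (simp add: geodesic_def)
  next
    case False
    have "dist (geodesic s) (geodesic s') \<le> h (\<tau> s (m s)) + h (\<tau> s' (m s')) - 2 * m s"
      unfolding geodesic_def
      using False t1(1) t2(1) assms future_min_le[OF ss(1)] by (intro tree) auto
    then show ?thesis using t1(2) t2(2) by simp
  qed
qed

lemma first_below_self:
  assumes "s \<in> {0..1}"
  shows "\<tau> s (h s) = s"
  using first_below(1,4)[OF assms future_min_le_self[OF assms] order_refl] assms
  by (metis atLeastAtMost_iff order_antisym order_refl)

lemma lipschitz_geodesic: "L-lipschitz_on {0..1} geodesic"
proof (rule lipschitz_on_leI)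
  fix x y :: real assume "x \<in> {0..1}" "y \<in> {0..1}" "x \<le> y"
  then show "dist (geodesic x) (geodesic y) \<le> L * dist x y"
    using dist_geodesic[of x y] future_min_lipschitz[of x y] by (simp add: dist_real_def)
qed (rule L_nonneg)

text \<open>Each point slides down the tree towards the root until it meets the geodesic.\<close>

lemma lipschitz_homotopic_geodesic:
  assumes "lipschitz_path g"
  shows "lipschitz_homotopic g geodesic"
proof -
  \<comment> \<open>Sliding at speed \<open>L\<close>, with a stop on the branch. As
    \<open>h s \<le> L * s\<close>, every point has arrived at time 1.\<close>
  define V where "V s r = max (m s) (h s - L * r)" for s r
  define H where "H z = g (\<tau> (fst z) (V (fst z) (snd z)))" for z
  have V: "m s \<le> V s r" "V s r \<le> h s" if "s \<in> {0..1}" "r \<in> {0..1}" for s r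
    using future_min_le_self[OF that(1)] that L_nonneg by (auto simp: V_def)
  have V0: "V s 0 = h s" if "s \<in> {0..1}" for s
    using future_min_le_self[OF that] by (simp add: V_def)
  have V1: "V s 1 = m s" if "s \<in> {0..1}" for s
  proof -
    have "h s \<le> L * s" using h_lip[of s 0] h_0 that by auto
    also have "\<dots> \<le> L * 1" using that L_nonneg by (intro mult_left_mono) auto
    moreover have "0 \<le> m s" using future_min_mono[of 0 s] future_min_0 that by auto
    ultimately show ?thesis by (simp add: V_def)
  qed
  \<comment> \<open>\<open>L\<close> comes from the change of \<open>V\<close>, \<open>2 * L\<close>
    from \<open>dist_first_below\<close>.\<close>
  have le: "dist (H (s, r)) (H (s', r')) \<le> 3 * L * (\<bar>s - s'\<bar> + \<bar>r - r'\<bar>)"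
    if "s \<in> {0..1}" "r \<in> {0..1}" "s' \<in> {0..1}" "r' \<in> {0..1}" "s \<le> s'" for s r s' r'
  proof -
    have "\<bar>V s r - V s' r'\<bar> \<le> max \<bar>m s - m s'\<bar> \<bar>(h s - L * r) - (h s' - L * r')\<bar>"
      unfolding V_def by (auto simp: max_def abs_if)
    moreover have "\<bar>m s - m s'\<bar> \<le> L * \<bar>s - s'\<bar>"
      using future_min_mono[of s s'] future_min_lipschitz[of s s'] that by auto
    moreover have "\<bar>(h s - L * r) - (h s' - L * r')\<bar> \<le> L * \<bar>s - s'\<bar> + L * \<bar>r - r'\<bar>"
    proof -
      have "\<bar>(h s - L * r) - (h s' - L * r')\<bar> \<le> \<bar>h s - h s'\<bar> + \<bar>L * (r - r')\<bar>"
        by (simp add: algebra_simps)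
      then show ?thesis using h_lip[of s s'] that L_nonneg by (simp add: abs_mult)
    qed
    moreover have "0 \<le> L * \<bar>r - r'\<bar>" using L_nonneg by simp
    ultimately have "\<bar>V s r - V s' r'\<bar> \<le> L * \<bar>s - s'\<bar> + L * \<bar>r - r'\<bar>" by linarith
    moreover have "dist (H (s, r)) (H (s', r')) \<le> \<bar>V s r - V s' r'\<bar> + 2 * L * (s' - s)"
      unfolding H_def using that V by (simp add: dist_first_below(2))
    moreover have "\<bar>s - s'\<bar> = s' - s" using that by simp
    ultimately show ?thesis using \<open>0 \<le> L * \<bar>r - r'\<bar>\<close> by (simp add: algebra_simps)
  qed
  have "lipschitz_square H"
    unfolding lipschitz_square_def
  proof (intro exI[of _ "3 * L"] conjI ballI)
    fix s r s' r' :: real assume "s \<in> {0..1}" "r \<in> {0..1}" "s' \<in> {0..1}" "r' \<in> {0..1}"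
    then show "dist (H (s, r)) (H (s', r')) \<le> 3 * L * (\<bar>s - s'\<bar> + \<bar>r - r'\<bar>)"
      using le[of s r s' r'] le[of s' r' s r] by (cases "s \<le> s'") (auto simp: dist_commute abs_minus_commute)
  qed (use L_nonneg in auto)
  moreover have "H (t, 0) = g t" "H (t, 1) = geodesic t" if "t \<in> {0..1}" for t
    using V0[OF that] V1[OF that] first_below_self[OF that] by (simp_all add: H_def geodesic_def)
  moreover have "H (0, r) = g 0" "H (1, r) = g 1" if "r \<in> {0..1}" for r
  proof -
    have "V 0 r = h 0" "V 1 r = h 1"
      using V[of 0 r] V[of 1 r] that future_min_0 future_min_1 h_0 by auto
    then show "H (0, r) = g 0" "H (1, r) = g 1"
      using first_below_self[of 0] first_below_self[of 1] by (simp_all add: H_def)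
  qed
  moreover have "geodesic 0 = g 0" "geodesic 1 = g 1"
    using first_below_self[of 0] first_below_self[of 1] future_min_0 future_min_1 h_0
    by (simp_all add: geodesic_def)
  moreover have "lipschitz_path geodesic"
    using lipschitz_geodesic unfolding lipschitz_path_def by blast
  ultimately show ?thesis
    unfolding lipschitz_homotopic_def using assms by metis
qed

end

section \<open>Arc length of Lipschitz paths as a cost\<close>

lemma partition_mono:
  fixes t :: "nat \<Rightarrow> real"
  assumes "\<And>i. i < n \<Longrightarrow> t i \<le> t (Suc i)" "i \<le> j" "j \<le> n"
  shows "t i \<le> t j"
  using assms(2,3)
proof (induction j rule: dec_induct)
  case (step j)
  then show ?case using assms(1)[of j] by auto
qed simp

lemma path_length_le:
  assumes "\<And>x y. 0 \<le> x \<Longrightarrow> x \<le> y \<Longrightarrow> y \<le> 1 \<Longrightarrow> dist (p x) (p y) \<le> \<mu> y - \<mu> x"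
  shows "path_length p \<le> ennreal (\<mu> 1 - \<mu> 0)"
  unfolding path_length_def
proof (rule SUP_least, clarify)
  fix n and t :: "nat \<Rightarrow> real"
  assume t: "t 0 = 0" "t n = 1" "\<forall>i<n. t i \<le> t (Suc i)"
  have "(\<Sum>i<n. dist (p (t i)) (p (t (Suc i)))) \<le> (\<Sum>i<n. \<mu> (t (Suc i)) - \<mu> (t i))"
  proof (rule sum_mono)
    fix i assume "i \<in> {..<n}"
    then show "dist (p (t i)) (p (t (Suc i))) \<le> \<mu> (t (Suc i)) - \<mu> (t i)"
      using partition_mono[of n t 0 i] partition_mono[of n t "Suc i" n] t by (intro assms) auto
  qed
  also have "\<dots> = \<mu> 1 - \<mu> 0"
    using sum_lessThan_telescope[of "\<lambda>i. \<mu> (t i)" n] t by simp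
  finally show "ennreal (\<Sum>i<n. dist (p (t i)) (p (t (Suc i)))) \<le> ennreal (\<mu> 1 - \<mu> 0)"
    by (rule ennreal_leI)
qed

text \<open>The supremum is arc length as a function of \<open>x\<close>, the
  \<open>\<kappa>\<close> of \<open>cost_path_length\<close>.\<close>

definition variation_sums :: "(real \<Rightarrow> 'a::metric_space) \<Rightarrow> real \<Rightarrow> real set" where
  "variation_sums p x = {\<Sum>i<n. dist (p (t i)) (p (t (Suc i))) | n t.
     t 0 = 0 \<and> t n = x \<and> (\<forall>i<n. t i \<le> t (Suc i))}"

lemma variation_sumsE:
  assumes "a \<in> variation_sums p x"
  obtains n t where "t 0 = 0" "t n = x" "\<forall>i<n. t i \<le> t (Suc i)"
    "a = (\<Sum>i<n. dist (p (t i)) (p (t (Suc i))))"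
  using assms unfolding variation_sums_def by blast

lemma variation_sums_le:
  assumes lip: "L-lipschitz_on {0..1} p" and "0 \<le> x" "x \<le> y" "y \<le> 1" and b: "b \<in> variation_sums p y"
  shows "\<exists>a\<in>variation_sums p x. b \<le> a + L * (y - x)"
proof -
  obtain n t where t: "t 0 = 0" "t n = y" "\<forall>i<n. t i \<le> t (Suc i)"
    and b_eq: "b = (\<Sum>i<n. dist (p (t i)) (p (t (Suc i))))"
    using b by (rule variation_sumsE)
  \<comment> \<open>The partition is cut at \<open>x\<close>: \<open>r\<close> is the part below,
    \<open>q\<close> the part above, where the Lipschitz constant bounds the sum.\<close>
  define r where "r i = min (t i) x" for i
  define q where "q i = max (t i) x" for i
  have range: "0 \<le> t i" "t i \<le> y" if "i \<le> n" for i
    using partition_mono[of n t 0 i] partition_mono[of n t i n] t that by auto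
  have "(\<Sum>i<n. dist (p (r i)) (p (r (Suc i)))) \<in> variation_sums p x"
    unfolding variation_sums_def using t assms(2,3)
    by (intro CollectI exI[of _ n] exI[of _ r]) (auto simp: r_def min_le_iff_disj)
  moreover have "b \<le> (\<Sum>i<n. dist (p (r i)) (p (r (Suc i))) + L * (q (Suc i) - q i))"
    unfolding b_eq
  proof (rule sum_mono)
    fix i assume "i \<in> {..<n}"
    then have i: "i < n" by simp
    have ti: "t i \<le> t (Suc i)" "0 \<le> t i" "t (Suc i) \<le> 1" using t(3) i range[of i] range[of "Suc i"] assms(4) by auto
    have "0 \<le> L" by (rule lipschitz_on_nonneg[OF lip])
    consider "t (Suc i) \<le> x" | "x \<le> t i" | "t i < x" "x < t (Suc i)" by linarith
    then show "dist (p (t i)) (p (t (Suc i))) \<le> dist (p (r i)) (p (r (Suc i))) + L * (q (Suc i) - q i)"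
    proof cases
      case 1
      then show ?thesis using ti by (simp add: r_def q_def)
    next
      case 2
      then show ?thesis
        using lipschitz_onD[OF lip, of "t i" "t (Suc i)"] ti by (simp add: r_def q_def dist_real_def)
    next
      case 3
      have "dist (p (t i)) (p (t (Suc i))) \<le> dist (p (t i)) (p x) + dist (p x) (p (t (Suc i)))"
        by (rule dist_triangle)
      also have "dist (p x) (p (t (Suc i))) \<le> L * (t (Suc i) - x)"
        using lipschitz_onD[OF lip, of x "t (Suc i)"] 3 ti assms(2) by (simp add: dist_real_def)
      finally show ?thesis using 3 by (simp add: r_def q_def)
    qed
  qed
  moreover have "(\<Sum>i<n. L * (q (Suc i) - q i)) = L * (y - x)"
    using sum_lessThan_telescope[of q n] t assms(2,3) by (simp add: sum_distrib_left[symmetric] q_def)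
  ultimately show ?thesis by (auto simp: sum.distrib)
qed

lemma variation_sums_extend:
  assumes "a \<in> variation_sums p x" "x \<le> y"
  shows "a + dist (p x) (p y) \<in> variation_sums p y"
proof -
  obtain n t where t: "t 0 = 0" "t n = x" "\<forall>i<n. t i \<le> t (Suc i)"
    and a_eq: "a = (\<Sum>i<n. dist (p (t i)) (p (t (Suc i))))"
    using assms(1) by (rule variation_sumsE)
  define t' where "t' = t(Suc n := y)"
  have "(\<Sum>i<Suc n. dist (p (t' i)) (p (t' (Suc i)))) = a + dist (p x) (p y)"
    unfolding sum.lessThan_Suc a_eq using t by (simp add: t'_def)
  moreover have "t' 0 = 0 \<and> t' (Suc n) = y \<and> (\<forall>i<Suc n. t' i \<le> t' (Suc i))"
    using t assms(2) by (auto simp: t'_def less_Suc_eq)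
  ultimately show ?thesis unfolding variation_sums_def by (intro CollectI exI[of _ "Suc n"] exI[of _ t']) simp
qed

text \<open>Arc length is itself a length bound, continuous because Lipschitz. This ties heights to
  the lengths of competing paths.\<close>

lemma cost_path_length:
  assumes lip: "L-lipschitz_on {0..1} p" and thin: "thin_homotopic p p"
  obtains l where "cost p l" "ennreal l \<le> path_length p"
proof -
  define \<kappa> where "\<kappa> x = Sup (variation_sums p x)" for x
  have zero: "variation_sums p 0 = {0}"
  proof -
    have "b \<le> 0 \<and> 0 \<le> b" if b0: "b \<in> variation_sums p 0" for b
    proof -
      obtain n t where t: "t 0 = 0" "t n = 0" "\<forall>i<n. t i \<le> t (Suc i)"
        and b: "b = (\<Sum>i<n. dist (p (t i)) (p (t (Suc i))))"
        using b0 by (rule variation_sumsE)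
      have "t i = 0" if "i \<le> n" for i
        using partition_mono[of n t 0 i] partition_mono[of n t i n] t that by auto
      then show ?thesis unfolding b by simp
    qed
    moreover have "0 \<in> variation_sums p 0"
      unfolding variation_sums_def by (intro CollectI exI[of _ 0] exI[of _ "\<lambda>_. 0"]) auto
    ultimately show ?thesis by (auto intro: antisym)
  qed
  have ne: "variation_sums p x \<noteq> {}" if "0 \<le> x" for x
    using variation_sums_extend[of 0 p 0 x] zero that by auto
  have bound: "a \<le> L * x" if "a \<in> variation_sums p x" "0 \<le> x" "x \<le> 1" for a x
    using variation_sums_le[OF lip _ that(2,3,1)] zero by auto
  then have bdd: "bdd_above (variation_sums p x)" if "0 \<le> x" "x \<le> 1" for x
    using that by (meson bdd_aboveI)
  have lower: "dist (p x) (p y) \<le> \<kappa> y - \<kappa> x" if "0 \<le> x" "x \<le> y" "y \<le> 1" for x y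
  proof -
    have "\<kappa> x \<le> \<kappa> y - dist (p x) (p y)"
      unfolding \<kappa>_def
    proof (rule cSup_least)
      fix a assume "a \<in> variation_sums p x"
      then have "a + dist (p x) (p y) \<le> Sup (variation_sums p y)"
        using that by (intro cSup_upper variation_sums_extend bdd) auto
      then show "a \<le> Sup (variation_sums p y) - dist (p x) (p y)" by simp
    qed (use ne that in auto)
    then show ?thesis by simp
  qed
  have upper: "\<kappa> y - \<kappa> x \<le> L * (y - x)" if xy: "0 \<le> x" "x \<le> y" "y \<le> 1" for x y
  proof -
    have "\<kappa> y \<le> \<kappa> x + L * (y - x)"
      unfolding \<kappa>_def
    proof (rule cSup_least)
      fix b assume "b \<in> variation_sums p y"
      then obtain a where "a \<in> variation_sums p x" "b \<le> a + L * (y - x)"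
        using variation_sums_le[OF lip xy] by blast
      moreover from this(1) have "a \<le> Sup (variation_sums p x)" using bdd that by (intro cSup_upper) auto
      ultimately show "b \<le> Sup (variation_sums p x) + L * (y - x)" by simp
    qed (use ne that in auto)
    then show ?thesis by simp
  qed
  have "L-lipschitz_on {0..1} \<kappa>"
  proof (rule lipschitz_on_leI)
    fix x y :: real assume xy: "x \<in> {0..1}" "y \<in> {0..1}" "x \<le> y"
    have "0 \<le> dist (p x) (p y)" by simp
    also have "\<dots> \<le> \<kappa> y - \<kappa> x" using xy by (intro lower) auto
    finally show "dist (\<kappa> x) (\<kappa> y) \<le> L * dist x y" using upper[of x y] xy by (simp add: dist_real_def)
  qed (rule lipschitz_on_nonneg[OF lip])
  then have "length_control \<kappa> p"
    unfolding length_control_def using lower lipschitz_on_continuous_on by blast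
  then have "cost p (\<kappa> 1 - \<kappa> 0)" using thin unfolding cost_def by blast
  moreover have "\<kappa> 0 = 0" using zero by (simp add: \<kappa>_def)
  moreover have "ennreal (\<kappa> 1) \<le> path_length p"
  proof (cases "path_length p = top")
    case False
    have "\<kappa> 1 \<le> enn2real (path_length p)"
      unfolding \<kappa>_def
    proof (rule cSup_least)
      fix a assume "a \<in> variation_sums p 1"
      then obtain n t where t: "t 0 = 0" "t n = 1" "\<forall>i<n. t i \<le> t (Suc i)"
        and a: "a = (\<Sum>i<n. dist (p (t i)) (p (t (Suc i))))"
        by (rule variation_sumsE)
      have "ennreal a \<le> path_length p"
        unfolding path_length_def a using t by (intro SUP_upper2[of "(n, t)"]) auto
      then have "enn2real (ennreal a) \<le> enn2real (path_length p)"
        using False by (intro enn2real_mono) (auto simp: less_top)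
      moreover have "0 \<le> a" unfolding a by (intro sum_nonneg) auto
      ultimately show "a \<le> enn2real (path_length p)" by simp
    qed (use ne in auto)
    then have "ennreal (\<kappa> 1) \<le> ennreal (enn2real (path_length p))" by (rule ennreal_leI)
    also have "\<dots> = path_length p" using False by (intro ennreal_enn2real) (simp add: less_top)
    finally show ?thesis .
  qed simp
  ultimately show ?thesis using that by simp
qed

section \<open>From Lipschitz maps to thin homotopies\<close>

lemma purely_2_unrectifiable_lipschitz_image:
  fixes f :: "real \<times> real \<Rightarrow> 'a::metric_space"
  assumes "purely_2_unrectifiable TYPE('a)" "closed S" "L-lipschitz_on S f"
  shows "hausdorff_measure 2 (f ` S) = 0"
  using assms borel_closed unfolding purely_2_unrectifiable_def by blast

lemma thin_lipschitz_path:
  fixes p :: "real \<Rightarrow> 'a::metric_space"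
  assumes "purely_2_unrectifiable TYPE('a)" "L-lipschitz_on {0..1} p"
  shows "thin_homotopic p p"
proof -
  \<comment> \<open>The hypothesis concerns planar sets, so the path is read as a map on a segment
    in the plane.\<close>
  have "hausdorff_measure 2 ((\<lambda>z. p (fst z)) ` ({0..1} \<times> {0::real})) = 0"
  proof (rule purely_2_unrectifiable_lipschitz_image[OF assms(1), where L = L])
    show "L-lipschitz_on ({0..1} \<times> {0}) (\<lambda>z. p (fst z))"
      using assms(2) by (auto simp: lipschitz_on_def dist_Pair_Pair)
  qed (intro closed_Times, auto)
  moreover have "(\<lambda>z. p (fst z)) ` ({0..1} \<times> {0::real}) = path_image p"
    by (force simp: path_image_def)
  ultimately show ?thesis
    using lipschitz_on_continuous_on[OF assms(2)] by (simp add: thin_homotopic_refl_iff path_def)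
qed

lemma thin_lipschitz_homotopic:
  fixes p q :: "real \<Rightarrow> 'a::metric_space"
  assumes "purely_2_unrectifiable TYPE('a)" "lipschitz_homotopic p q"
  shows "thin_homotopic p q"
proof -
  obtain H where H: "lipschitz_square H" "\<And>t. t \<in> {0..1} \<Longrightarrow> H (t, 0) = p t" "\<And>t. t \<in> {0..1} \<Longrightarrow> H (t, 1) = q t"
      "\<And>s. s \<in> {0..1} \<Longrightarrow> H (0, s) = p 0" "\<And>s. s \<in> {0..1} \<Longrightarrow> H (1, s) = p 1"
    using assms(2) unfolding lipschitz_homotopic_def by blast
  obtain L where L: "L \<ge> 0" "\<And>s t s' t'. s \<in> {0..1} \<Longrightarrow> t \<in> {0..1} \<Longrightarrow> s' \<in> {0..1} \<Longrightarrow> t' \<in> {0..1} \<Longrightarrow>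
      dist (H (s, t)) (H (s', t')) \<le> L * (\<bar>s - s'\<bar> + \<bar>t - t'\<bar>)"
    using H(1) unfolding lipschitz_square_def by blast
  let ?Q = "{0..1::real} \<times> {0..1::real}"
  \<comment> \<open>The \<open>L\<^sup>1\<close> distance is at most twice the Euclidean
    one.\<close>
  have "(2 * L)-lipschitz_on ?Q H"
  proof (rule lipschitz_onI)
    fix z w :: "real \<times> real" assume zw: "z \<in> ?Q" "w \<in> ?Q"
    have "dist (H z) (H w) \<le> L * (\<bar>fst z - fst w\<bar> + \<bar>snd z - snd w\<bar>)"
      using L(2)[of "fst z" "snd z" "fst w" "snd w"] zw by (auto simp: mem_Times_iff)
    also have "\<dots> \<le> L * (dist z w + dist z w)"
      using L(1) dist_fst_le[of z w] dist_snd_le[of z w]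
      by (intro mult_left_mono add_mono) (auto simp: dist_real_def)
    finally show "dist (H z) (H w) \<le> 2 * L * dist z w" by simp
  qed (use L in simp)
  moreover have "closed ?Q" by (intro closed_Times) auto
  ultimately have "hausdorff_measure 2 (H ` ?Q) = 0" and contH: "continuous_on ?Q H"
    using purely_2_unrectifiable_lipschitz_image[OF assms(1)] lipschitz_on_continuous_on by blast+
  moreover have "homotopic_paths (H ` ?Q) p q"
    unfolding homotopic_paths
  \<comment> \<open>\<open>homotopic_paths\<close> takes the homotopy parameter first,
    \<open>lipschitz_homotopic\<close> second.\<close>
  proof (intro exI[of _ "H \<circ> prod.swap"] conjI ballI)
    show "continuous_on ?Q (H \<circ> prod.swap)"
      by (intro continuous_on_compose continuous_on_swap) (simp add: contH product_swap)
    show "H \<circ> prod.swap \<in> ?Q \<rightarrow> H ` ?Q" by auto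
  qed (use H(2-5) in \<open>auto simp: pathstart_def pathfinish_def\<close>)
  ultimately show ?thesis unfolding thin_homotopic_def by blast
qed

lemma lipschitz_join_reversepath:
  assumes p: "L-lipschitz_on {0..1} p" and q: "M-lipschitz_on {0..1} q" and "p 1 = q 1"
  obtains K where "K-lipschitz_on {0..1} (p +++ reversepath q)"
proof -
  have "(L * 2)-lipschitz_on {0..1/2} (\<lambda>x. p (2 * x))"
  proof (rule lipschitz_onI)
    fix x y :: real assume "x \<in> {0..1/2}" "y \<in> {0..1/2}"
    then have "dist (p (2 * x)) (p (2 * y)) \<le> L * dist (2 * x) (2 * y)"
      by (intro lipschitz_onD[OF p]) auto
    also have "dist (2 * x) (2 * y) = 2 * dist x y" by (simp add: dist_real_def abs_if)
    finally show "dist (p (2 * x)) (p (2 * y)) \<le> L * 2 * dist x y" by simp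
  qed (use lipschitz_on_nonneg[OF p] in simp)
  moreover have "(M * 2)-lipschitz_on {1/2..1} (\<lambda>x. reversepath q (2 * x - 1))"
  proof (rule lipschitz_onI)
    fix x y :: real assume "x \<in> {1/2..1}" "y \<in> {1/2..1}"
    then have "dist (q (1 - (2 * x - 1))) (q (1 - (2 * y - 1)))
        \<le> M * dist (1 - (2 * x - 1)) (1 - (2 * y - 1))"
      by (intro lipschitz_onD[OF q]) auto
    also have "dist (1 - (2 * x - 1)) (1 - (2 * y - 1)) = 2 * dist x y"
      by (simp add: dist_real_def abs_if)
    finally show "dist (reversepath q (2 * x - 1)) (reversepath q (2 * y - 1)) \<le> M * 2 * dist x y"
      by (simp add: reversepath_def)
  qed (use lipschitz_on_nonneg[OF q] in simp)
  ultimately have "(max (L * 2) (M * 2))-lipschitz_on {0..1} (p +++ reversepath q)"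
    unfolding joinpaths_def using assms(3)
    by (intro lipschitz_on_concat_max) (auto simp: reversepath_def)
  then show ?thesis using that by blast
qed

theorem theorem1p1:
  fixes \<gamma> :: "real \<Rightarrow> 'a::metric_space"
  assumes "purely_2_unrectifiable TYPE('a)"
    and "lipschitz_path \<gamma>"
  shows "\<exists>\<gamma>\<^sub>0 \<in> homotopy_class \<gamma>.
           path_length \<gamma>\<^sub>0 = (INF \<alpha> \<in> homotopy_class \<gamma>. path_length \<alpha>) \<and>
           (\<forall>\<alpha> \<in> homotopy_class \<gamma>. path_image \<gamma>\<^sub>0 \<subseteq> path_image \<alpha>)"
proof -
  obtain L where L: "L-lipschitz_on {0..1} \<gamma>" using assms(2) unfolding lipschitz_path_def by blast
  note thin = thin_lipschitz_path[OF assms(1) L]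
  interpret tree_path \<gamma> "height \<gamma>" L
    by unfold_locales (use height_lipschitz[OF L thin] height_0[OF L thin] height_nonneg[OF L thin]
        height_tree_inequality[OF L thin] in auto)
  have mem: "geodesic \<in> homotopy_class \<gamma>"
    unfolding homotopy_class_def using lipschitz_homotopic_geodesic[OF assms(2)] by simp
  have shortest: "path_length geodesic \<le> path_length \<alpha>" and image: "path_image geodesic \<subseteq> path_image \<alpha>"
    if "\<alpha> \<in> homotopy_class \<gamma>" for \<alpha>
  proof -
    have hom: "lipschitz_homotopic \<gamma> \<alpha>" using that by (simp add: homotopy_class_def)
    then obtain M where M: "M-lipschitz_on {0..1} \<alpha>"
      unfolding lipschitz_homotopic_def lipschitz_path_def by blast
    note th = thin_lipschitz_homotopic[OF assms(1) hom]
    have ends: "\<gamma> 0 = \<alpha> 0" "\<gamma> 1 = \<alpha> 1" using hom by (auto simp: lipschitz_homotopic_def)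
    obtain l where l: "cost \<alpha> l" "ennreal l \<le> path_length \<alpha>"
      using cost_path_length[OF M thin_homotopic_refl2[OF th]] .
    \<comment> \<open>\<open>height \<gamma> 1\<close> bounds the length of the geodesic from above
      and that of each competitor from below.\<close>
    have "path_length geodesic \<le> ennreal (m 1 - m 0)" by (rule path_length_le) (rule dist_geodesic)
    also have "m 1 - m 0 = height \<gamma> 1" by (simp add: future_min_0 future_min_1)
    also have "\<dots> \<le> l"
      using cost_cong[OF l(1) thin_homotopic_sym[OF th]] by (intro height_le) simp
    finally show "path_length geodesic \<le> path_length \<alpha>" using l(2) by (simp add: ennreal_leI order_trans)
    show "path_image geodesic \<subseteq> path_image \<alpha>"
    proof
      fix z assume "z \<in> path_image geodesic"
      then obtain s where s: "s \<in> {0..1}" "z = \<gamma> (\<tau> s (m s))"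
        unfolding path_image_def geodesic_def by blast
      define t where "t = \<tau> s (m s)"
      note fb = first_below[OF s(1) order_refl future_min_le_self[OF s(1)]]
      have t: "t \<in> {0..1}" "height \<gamma> t = m s" using fb s(1) by (auto simp: t_def)
      have m_le: "m s \<le> height \<gamma> u" if "u \<in> {t..1}" for u
        using that fb(1) s(1) by (intro future_min_le) (auto simp: t_def)
      \<comment> \<open>A contractible loop: its height is 0 again at the end, so on the way back
        along \<open>\<alpha>\<close> it must pass the height \<open>m s\<close>.\<close>
      define \<delta> where "\<delta> = \<gamma> +++ reversepath \<alpha>"
      obtain K where K: "K-lipschitz_on {0..1} \<delta>"
        using lipschitz_join_reversepath[OF L M ends(2)] unfolding \<delta>_def by blast
      note thin_\<delta> = thin_lipschitz_path[OF assms(1) K]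
      interpret \<delta>: tree_path \<delta> "height \<delta>" K
        by unfold_locales (use height_lipschitz[OF K thin_\<delta>] height_0[OF K thin_\<delta>]
            height_nonneg[OF K thin_\<delta>] height_tree_inequality[OF K thin_\<delta>] in auto)
      have height_\<delta>: "height \<delta> (u / 2) = height \<gamma> u" if "u \<in> {0..1}" for u
      proof -
        have "thin_homotopic (subarc 0 (u / 2) \<delta>) (subarc 0 u \<gamma>)"
          using thin_homotopic_subarc_join_left[OF thin, of 0 u "reversepath \<alpha>"] that by (simp add: \<delta>_def)
        then have "cost (subarc 0 (u / 2) \<delta>) = cost (subarc 0 u \<gamma>)"
          using cost_cong thin_homotopic_sym by (intro ext iffI) blast+
        then show ?thesis by (simp add: height_def)
      qed
      have "height \<delta> 1 \<le> 0"
      proof (rule height_le)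
        have "\<alpha> 0 = \<delta> 0" by (simp add: \<delta>_def joinpaths_def ends)
        then have "thin_homotopic \<delta> (subarc 0 0 \<delta>)"
          using thin_homotopic_join_reversepath[OF th] by (simp add: \<delta>_def subarc_refl)
        then show "cost (subarc 0 1 \<delta>) 0"
          using cost_lipschitz[OF K thin_\<delta>, of 0 0] cost_cong thin_homotopic_sym by fastforce
      qed
      then have \<delta>m: "\<delta>.m (1/2) \<le> m s"
        using \<delta>.future_min_le[of "1/2" 1] future_min_mono[of 0 s] future_min_0 s(1) by auto
      have half: "m s \<le> height \<delta> (1/2)" using height_\<delta>[of 1] m_le[of 1] t(1) by simp
      \<comment> \<open>From \<open>t / 2\<close> to this first passage the height stays at least
        \<open>m s\<close>, with equality at both ends, so the tree inequality makes the two points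
        coincide.\<close>
      define y where "y = \<delta>.\<tau> (1/2) (m s)"
      have "(1/2::real) \<in> {0..1}" by simp
      note fb' = \<delta>.first_below[OF this \<delta>m half, folded y_def]
      have "dist (\<delta> (t / 2)) (\<delta> y) \<le> height \<delta> (t / 2) + height \<delta> y - 2 * m s"
      proof (rule \<delta>.tree)
        fix u assume u: "u \<in> {t / 2..y}"
        show "m s \<le> height \<delta> u"
        proof (cases "u \<le> 1/2")
          case True
          then have "m s \<le> height \<gamma> (2 * u)" using u by (intro m_le) auto
          then show ?thesis using height_\<delta>[of "2 * u"] True u t(1) by simp
        next
          case False
          then show ?thesis using u fb'(3) by auto
        qed
      qed (use t(1) fb'(1) in auto)
      then have "\<delta> (t / 2) = \<delta> y" using height_\<delta>[OF t(1)] t(2) fb'(2) by simp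
      moreover have "\<delta> (t / 2) = \<gamma> t" using t(1) by (simp add: \<delta>_def joinpaths_left_half)
      moreover have "\<delta> y = \<alpha> (2 - 2 * y)"
      proof -
        have "\<delta> ((1 + (2 * y - 1)) / 2) = reversepath \<alpha> (2 * y - 1)"
          unfolding \<delta>_def using fb'(1) ends
          by (intro joinpaths_right_half) (auto simp: pathfinish_def pathstart_def reversepath_def)
        then show ?thesis by (simp add: reversepath_def)
      qed
      ultimately have "z = \<alpha> (2 - 2 * y)" using s(2) by (simp add: t_def)
      then show "z \<in> path_image \<alpha>" using fb'(1) unfolding path_image_def by auto
    qed
  qed
  have "path_length geodesic = (INF \<alpha> \<in> homotopy_class \<gamma>. path_length \<alpha>)"
    using mem shortest by (intro antisym INF_greatest INF_lower)
  then show ?thesis using mem image by blast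
qed

end
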